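(* Let $G$ be a locally compact group. If $G$ has the translate property for $\mathcal{C}^b_{ru}(G)$, then $G$ has the invariant normalized integral property for $\mathcal{C}^b_{ru}(G)$.
   Context: Locally compact groups are Hausdorff. $\mathcal{C}^b(G)$ is the space of bounded continuous real functions on $G$ with the supremum norm and pointwise order, with left-translation action $(gf)(x)=f(g^{-1}x)$. $\mathcal{C}^b_{ru}(G)$ is the space of $f\in\mathcal{C}^b(G)$ such that $g\mapsto gf$ is continuous for the supremum norm. $G$ has the translate property for $\mathcal{C}^b_{ru}(G)$ if for every non-zero $f\ge 0$ in $\mathcal{C}^b_{ru}(G)$, all $t_1,\dots,t_n\in\mathbf{R}$ and all $g_1,\dots,g_n\in G$: $\sum_{j=1}^n t_jg_jf\ge 0$ implies $\sum_{j=1}^n t_j\ge 0$. For a non-zero $f\ge 0$ in $\mathcal{C}^b_{ru}(G)$, let $\mathcal{C}^b_{ru}(G,f)$ be the set of all $h\in\mathcal{C}^b_{ru}(G)$ such that $|h|\le\sum_{j=1}^n g_jf$ for some $g_1,\dots,g_n\in G$; it is a $G$-invariant linear subspace. An invariant normalized integral on $\mathcal{C}^b_{ru}(G,f)$ is a positive, $G$-invariant linear functional $\mathrm{I}$ on it with $\mathrm{I}(f)=1$. $G$ has the invariant normalized integral property for $\mathcal{C}^b_{ru}(G)$ if $\mathcal{C}^b_{ru}(G,f)$ admits an invariant normalized integral for every non-zero $f\ge 0$ in $\mathcal{C}^b_{ru}(G)$. *)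

theory Defs
  imports "HOL-Analysis.Analysis"
begin

text \<open>Groups are written additively, as in the library class \<open>topological_group_add\<close>;
  addition is not assumed commutative.\<close>

unbundle bcontfun.lifting

lift_definition ltrans :: "'a::topological_group_add \<Rightarrow> ('a \<Rightarrow>\<^sub>C real) \<Rightarrow> ('a \<Rightarrow>\<^sub>C real)"
  is "\<lambda>g f x. f (- g + x)"
proof -
  fix g :: 'a and f :: "'a \<Rightarrow> real"
  assume f: "f \<in> bcontfun"
  have "continuous_on UNIV (f \<circ> (\<lambda>x. - g + x))"
    using f by (intro continuous_on_compose continuous_intros)
      (auto simp: bcontfun_def intro: continuous_on_subset)
  moreover have "bounded (range (\<lambda>x. f (- g + x)))"
    using f by (auto simp: bcontfun_def intro: bounded_subset)
  ultimately show "(\<lambda>x. f (- g + x)) \<in> bcontfun"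
    by (simp add: bcontfun_def o_def)
qed

definition Cb_ru :: "('a::topological_group_add \<Rightarrow>\<^sub>C real) set"
  where "Cb_ru = {f. continuous_on UNIV (\<lambda>g. ltrans g f)}"

definition translate_property :: "('a::topological_group_add \<Rightarrow>\<^sub>C real) set \<Rightarrow> bool"
  where "translate_property E \<longleftrightarrow>
    (\<forall>f\<in>E. f \<noteq> 0 \<and> (\<forall>x. 0 \<le> apply_bcontfun f x) \<longrightarrow>
      (\<forall>n. \<forall>t :: nat \<Rightarrow> real. \<forall>g :: nat \<Rightarrow> 'a.
        (\<forall>x. 0 \<le> apply_bcontfun (\<Sum>j<n. t j *\<^sub>R ltrans (g j) f) x) \<longrightarrow> 0 \<le> (\<Sum>j<n. t j)))"

definition dominated_by_translates ::
  "('a::topological_group_add \<Rightarrow>\<^sub>C real) set \<Rightarrow> ('a \<Rightarrow>\<^sub>C real) \<Rightarrow> ('a \<Rightarrow>\<^sub>C real) set"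
  where "dominated_by_translates E f =
    {h\<in>E. \<exists>n. \<exists>g :: nat \<Rightarrow> 'a. \<forall>x. \<bar>apply_bcontfun h x\<bar> \<le> apply_bcontfun (\<Sum>j<n. ltrans (g j) f) x}"

text \<open>The functional is total on bounded continuous functions, but its values outside
  \<open>dominated_by_translates E f\<close> are irrelevant.\<close>

definition invariant_normalized_integral ::
  "('a::topological_group_add \<Rightarrow>\<^sub>C real) set \<Rightarrow> ('a \<Rightarrow>\<^sub>C real) \<Rightarrow> (('a \<Rightarrow>\<^sub>C real) \<Rightarrow> real) \<Rightarrow> bool"
  where "invariant_normalized_integral E f I \<longleftrightarrow>
    (let V = dominated_by_translates E f in
      (\<forall>h\<in>V. \<forall>k\<in>V. I (h + k) = I h + I k) \<and>
      (\<forall>h\<in>V. \<forall>c. I (c *\<^sub>R h) = c * I h) \<and>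
      (\<forall>h\<in>V. (\<forall>x. 0 \<le> apply_bcontfun h x) \<longrightarrow> 0 \<le> I h) \<and>
      (\<forall>h\<in>V. \<forall>g. I (ltrans g h) = I h) \<and>
      I f = 1)"

definition invariant_normalized_integral_property ::
  "('a::topological_group_add \<Rightarrow>\<^sub>C real) set \<Rightarrow> bool"
  where "invariant_normalized_integral_property E \<longleftrightarrow>
    (\<forall>f\<in>E. f \<noteq> 0 \<and> (\<forall>x. 0 \<le> apply_bcontfun f x) \<longrightarrow> (\<exists>I. invariant_normalized_integral E f I))"

lemma ltrans_zero: "ltrans 0 f = f"
  by transfer simp

lemma ltrans_ltrans: "ltrans g (ltrans h f) = ltrans (g + h) f"
  by transfer (simp add: minus_add add.assoc del: add_uminus_conv_diff)

lemma ltrans_add: "ltrans g (f + h) = ltrans g f + ltrans g h"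
  by transfer simp

lemma ltrans_scaleR: "ltrans g (c *\<^sub>R f) = c *\<^sub>R ltrans g f"
  by transfer simp

lemma ltrans_0: "ltrans g 0 = 0"
  by transfer simp

lemma ltrans_sum: "ltrans g (sum F A) = (\<Sum>j\<in>A. ltrans g (F j))"
  by (induction A rule: infinite_finite_induct) (auto simp: ltrans_0 ltrans_add)

lemma sum_apply: "apply_bcontfun (sum F A) x = (\<Sum>j\<in>A. F j x)"
  for F :: "'i \<Rightarrow> 'a::topological_space \<Rightarrow>\<^sub>C real"
  by (induction A rule: infinite_finite_induct) auto

lemma subspace_Cb_ru: "subspace Cb_ru"
  unfolding subspace_def Cb_ru_def
  by (auto simp: ltrans_0 ltrans_add ltrans_scaleR intro!: continuous_intros)

lemma ltrans_Cb_ru: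
  assumes "f \<in> Cb_ru" shows "ltrans g f \<in> Cb_ru"
proof -
  have "continuous_on UNIV ((\<lambda>h. ltrans h f) \<circ> (\<lambda>h. h + g))"
    using assms unfolding Cb_ru_def
    by (intro continuous_on_compose continuous_intros) (auto intro: continuous_on_subset)
  then show ?thesis by (simp add: Cb_ru_def ltrans_ltrans o_def)
qed

lemma ltrans_dominated:
  assumes "h \<in> dominated_by_translates Cb_ru f"
  shows "ltrans g h \<in> dominated_by_translates Cb_ru f"
proof -
  obtain n and k :: "nat \<Rightarrow> 'a" where k: "\<And>x. \<bar>apply_bcontfun h x\<bar> \<le> apply_bcontfun (\<Sum>j<n. ltrans (k j) f) x"
    using assms by (auto simp: dominated_by_translates_def)
  have "\<bar>apply_bcontfun (ltrans g h) x\<bar> \<le> apply_bcontfun (\<Sum>j<n. ltrans (g + k j) f) x" for x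
    using k[of "- g + x"]
    by (simp add: sum_apply flip: ltrans_ltrans) (simp add: ltrans.rep_eq)
  moreover have "ltrans g h \<in> Cb_ru"
    using assms by (simp add: dominated_by_translates_def ltrans_Cb_ru)
  ultimately show ?thesis
    unfolding dominated_by_translates_def
    by (intro CollectI conjI exI[of _ n] exI[of _ "\<lambda>j. g + k j"] allI) auto
qed

lemma self_dominated:
  assumes "f \<in> E" "\<And>x. 0 \<le> apply_bcontfun f x"
  shows "f \<in> dominated_by_translates E f"
  unfolding dominated_by_translates_def
  using assms
  by (auto simp: ltrans_zero intro!: exI[of _ "Suc 0"] exI[of _ "\<lambda>_. 0"])

lemma sum_lessThan_append:
  fixes u :: "'a \<Rightarrow> 'b::comm_monoid_add" and m n :: nat
  shows "(\<Sum>j<m + n. u (if j < m then a j else b (j - m))) = (\<Sum>j<m. u (a j)) + (\<Sum>j<n. u (b j))"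
proof (induction n)
  case 0
  show ?case by (auto intro: sum.cong)
next
  case (Suc n)
  then show ?case by (simp add: add.assoc)
qed

lemma subspace_dominated:
  assumes nonneg: "\<And>x. 0 \<le> apply_bcontfun f x"
  shows "subspace (dominated_by_translates Cb_ru f)"
  unfolding subspace_def
proof (intro conjI ballI allI)
  show "0 \<in> dominated_by_translates Cb_ru f"
    using subspace_0[OF subspace_Cb_ru]
    by (auto simp: dominated_by_translates_def intro!: exI[of _ 0])
next
  fix h k assume hk: "h \<in> dominated_by_translates Cb_ru f" "k \<in> dominated_by_translates Cb_ru f"
  obtain m and a :: "nat \<Rightarrow> 'a" where a: "\<And>x. \<bar>apply_bcontfun h x\<bar> \<le> apply_bcontfun (\<Sum>j<m. ltrans (a j) f) x"
    using hk by (auto simp: dominated_by_translates_def)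
  obtain n and b :: "nat \<Rightarrow> 'a" where b: "\<And>x. \<bar>apply_bcontfun k x\<bar> \<le> apply_bcontfun (\<Sum>j<n. ltrans (b j) f) x"
    using hk by (auto simp: dominated_by_translates_def)
  have "\<bar>apply_bcontfun (h + k) x\<bar> \<le> apply_bcontfun (\<Sum>j<m + n. ltrans (if j < m then a j else b (j - m)) f) x" for x
    using a[of x] b[of x] by (simp add: sum_lessThan_append[of "\<lambda>g. ltrans g f"])
  moreover have "h + k \<in> Cb_ru"
    using hk by (simp add: dominated_by_translates_def subspace_add[OF subspace_Cb_ru])
  ultimately show "h + k \<in> dominated_by_translates Cb_ru f"
    unfolding dominated_by_translates_def
    by (intro CollectI conjI exI[of _ "m + n"] exI[of _ "\<lambda>j. if j < m then a j else b (j - m)"] allI)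
next
  fix c :: real and h assume h: "h \<in> dominated_by_translates Cb_ru f"
  obtain m and a :: "nat \<Rightarrow> 'a" where a: "\<And>x. \<bar>apply_bcontfun h x\<bar> \<le> apply_bcontfun (\<Sum>j<m. ltrans (a j) f) x"
    using h by (auto simp: dominated_by_translates_def)
  define N where "N = nat \<lceil>\<bar>c\<bar>\<rceil>"
  have N: "\<bar>c\<bar> \<le> real N" unfolding N_def by linarith
  have multiple: "\<exists>n. \<exists>b :: nat \<Rightarrow> 'a. (\<Sum>j<n. ltrans (b j) f) = real q *\<^sub>R (\<Sum>j<m. ltrans (a j) f)" for q
  proof (induction q)
    case 0 show ?case by (auto intro!: exI[of _ 0])
  next
    case (Suc q)
    then obtain n and b :: "nat \<Rightarrow> 'a"
      where "(\<Sum>j<n. ltrans (b j) f) = real q *\<^sub>R (\<Sum>j<m. ltrans (a j) f)" by blast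
    then have "(\<Sum>j<m + n. ltrans (if j < m then a j else b (j - m)) f)
        = real (Suc q) *\<^sub>R (\<Sum>j<m. ltrans (a j) f)"
      by (simp add: sum_lessThan_append[of "\<lambda>g. ltrans g f"] algebra_simps)
    then show ?case
      by (intro exI[of _ "m + n"] exI[of _ "\<lambda>j. if j < m then a j else b (j - m)"])
  qed
  then obtain n and b :: "nat \<Rightarrow> 'a"
    where b: "(\<Sum>j<n. ltrans (b j) f) = real N *\<^sub>R (\<Sum>j<m. ltrans (a j) f)" by blast
  have "\<bar>apply_bcontfun (c *\<^sub>R h) x\<bar> \<le> apply_bcontfun (\<Sum>j<n. ltrans (b j) f) x" for x
    using mult_mono[OF N a[of x]] by (simp add: b abs_mult)
  moreover have "c *\<^sub>R h \<in> Cb_ru"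
    using h by (simp add: dominated_by_translates_def subspace_scale[OF subspace_Cb_ru])
  ultimately show "c *\<^sub>R h \<in> dominated_by_translates Cb_ru f"
    unfolding dominated_by_translates_def
    by (intro CollectI conjI exI[of _ n] exI[of _ b] allI)
qed

end

theory Submission
  imports Defs
begin

text \<open>
  By Kantorovich's extension theorem, the translate property for \<open>f\<close> yields a positive linear functional
  \<open>L\<close> on the functions dominated by translates of \<open>f\<close> that takes the value 1 on every translate of \<open>f\<close>.
  For \<open>f = h + c\<close> with a large constant \<open>c\<close> this is, up to normalization, a mean that is constant on the
  orbit of \<open>h\<close>; iterating this (Moore) gives an invariant mean \<open>M\<close> on \<open>Cb_ru\<close>. The function
  \<open>x \<mapsto> L (ltrans (- x) h)\<close> is bounded, and it lies in \<open>Cb_ru\<close> as soon as the oscillation of \<open>h\<close> is controlled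
  by translates of \<open>f\<close>. Applying \<open>M\<close> to it produces an invariant integral on all such \<open>h\<close>.

  The function \<open>f\<close> itself need not have controlled oscillation. Taking a bump for \<open>f\<close> one first
  obtains a Haar integral on \<open>Cc\<close>. For \<open>\<phi>\<close> in \<open>Cc\<close>, the function \<open>F = \<phi> * f\<close> and all \<open>\<phi> * h\<close> with \<open>h\<close> dominated by
  translates of \<open>f\<close> have oscillation controlled by translates of \<open>F\<close>, because \<open>\<phi>\<close> does. If \<open>I\<close> is the invariant
  integral with \<open>I F = 1\<close>, then \<open>h \<mapsto> I (\<phi> * h)\<close> is the required integral: its invariance follows from the
  uniqueness of the Haar integral, since the two modular factors cancel.
\<close>

section \<open>Kantorovich's extension theorem for positive functionals\<close>

text \<open>Zorn's lemma applied to graphs. A partial functional is a linear relation in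
  \<open>V \<times> UNIV\<close>; single-valuedness need not be assumed, because positivity at
  \<open>(0, t)\<close> and \<open>(0, - t)\<close> forces \<open>t = 0\<close>. A maximal positive
  relation above \<open>R\<close> is total: by cofinality the values already assigned leave room for
  a value at any further vector.\<close>

lemma positive_extension:
  fixes V C :: "'v::real_vector set" and R :: "('v \<times> real) set"
  assumes V: "subspace V"
    and C0: "0 \<in> C" and Cadd: "\<And>x y. x \<in> C \<Longrightarrow> y \<in> C \<Longrightarrow> x + y \<in> C"
    and Cscale: "\<And>c x. 0 \<le> c \<Longrightarrow> x \<in> C \<Longrightarrow> c *\<^sub>R x \<in> C"
    and R: "subspace R" "R \<subseteq> V \<times> UNIV"
    and pos: "\<And>w t. (w, t) \<in> R \<Longrightarrow> w \<in> C \<Longrightarrow> 0 \<le> t"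
    and cofinal: "\<And>v. v \<in> V \<Longrightarrow> \<exists>w t. (w, t) \<in> R \<and> w - v \<in> C"
  shows "\<exists>L. (\<forall>v\<in>V. \<forall>w\<in>V. L (v + w) = L v + L w) \<and> (\<forall>v\<in>V. \<forall>c. L (c *\<^sub>R v) = c * L v) \<and>
    (\<forall>v\<in>V. v \<in> C \<longrightarrow> 0 \<le> L v) \<and> (\<forall>w t. (w, t) \<in> R \<longrightarrow> L w = t)"
proof -
  define A where "A = {S :: ('v \<times> real) set. subspace S \<and> R \<subseteq> S \<and> S \<subseteq> V \<times> UNIV \<and>
    (\<forall>w t. (w, t) \<in> S \<longrightarrow> w \<in> C \<longrightarrow> 0 \<le> t)}"
  have "\<exists>M\<in>A. \<forall>X\<in>A. M \<subseteq> X \<longrightarrow> X = M"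
  proof (rule subset_Zorn_nonempty)
    show "A \<noteq> {}" using R pos unfolding A_def by blast
  next
    fix K assume ne: "K \<noteq> {}" and ch: "subset.chain A K"
    have sub: "subspace S" "R \<subseteq> S" "S \<subseteq> V \<times> UNIV"
      and p: "\<And>w t. (w, t) \<in> S \<Longrightarrow> w \<in> C \<Longrightarrow> 0 \<le> t" if "S \<in> K" for S
      using ch that by (auto simp: subset.chain_def A_def)
    have "subspace (\<Union>K)"
    proof (rule subspaceI)
      show "0 \<in> \<Union>K" using ne sub(1) subspace_0 by blast
    next
      fix x y assume "x \<in> \<Union>K" "y \<in> \<Union>K"
      then obtain S T where ST: "x \<in> S" "y \<in> T" "S \<in> K" "T \<in> K" by blast
      then have "S \<subseteq> T \<or> T \<subseteq> S" using ch unfolding subset.chain_def by blast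
      then show "x + y \<in> \<Union>K"
        using ST sub(1) by (meson UnionI subsetD subspace_add)
    next
      fix c x assume "x \<in> \<Union>K"
      then show "c *\<^sub>R x \<in> \<Union>K" using sub(1) by (meson UnionE UnionI subspace_scale)
    qed
    moreover have "R \<subseteq> \<Union>K" using ne sub(2) by blast
    moreover have "\<Union>K \<subseteq> V \<times> UNIV" using sub(3) by blast
    moreover have "0 \<le> t" if "(w, t) \<in> \<Union>K" "w \<in> C" for w t
      using that p by (meson UnionE)
    ultimately show "\<Union>K \<in> A" unfolding A_def by blast
  qed
  then obtain M where M: "M \<in> A" and maxi: "\<And>X. X \<in> A \<Longrightarrow> M \<subseteq> X \<Longrightarrow> X = M" by blast
  have sM: "subspace M" and RM: "R \<subseteq> M" and MV: "M \<subseteq> V \<times> UNIV"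
    and pM: "\<And>w t. (w, t) \<in> M \<Longrightarrow> w \<in> C \<Longrightarrow> 0 \<le> t"
    using M unfolding A_def by auto
  have add: "(w + w', t + t') \<in> M" if "(w, t) \<in> M" "(w', t') \<in> M" for w w' t t'
    using subspace_add[OF sM that] by simp
  have scale: "(c *\<^sub>R w, c * t) \<in> M" if "(w, t) \<in> M" for c w t
    using subspace_scale[OF sM that, of c] by simp
  have diff: "(w - w', t - t') \<in> M" if "(w, t) \<in> M" "(w', t') \<in> M" for w w' t t'
    using subspace_diff[OF sM that] by simp
  have unique: "t = t'" if "(w, t) \<in> M" "(w, t') \<in> M" for w t t'
    using pM[OF diff[OF that]] pM[OF diff[OF that(2,1)]] C0 by simp
  have total: "\<exists>t. (v, t) \<in> M" if v: "v \<in> V" for v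
  proof -
    \<comment> \<open>\<open>lo\<close> collects the values at vectors below \<open>v\<close> in the
      order given by \<open>C\<close>. Cofinality at \<open>v\<close> bounds it from above, and
      cofinality at \<open>- v\<close> shows that it is nonempty.\<close>
    define lo where "lo = {t. \<exists>w. (w, t) \<in> M \<and> v - w \<in> C}"
    have le: "s \<le> t" if "(w, s) \<in> M" "v - w \<in> C" "(w', t) \<in> M" "w' - v \<in> C" for w s w' t
    proof -
      have "w' - w \<in> C" using Cadd[OF that(2,4)] by simp
      then show ?thesis using pM[OF diff[OF that(3,1)]] by simp
    qed
    obtain w1 t1 where w1: "(w1, t1) \<in> M" "w1 - v \<in> C" using cofinal[OF v] RM by blast
    obtain w2 t2 where w2: "(w2, t2) \<in> M" "w2 - (- v) \<in> C"
      using cofinal[OF subspace_neg[OF V v]] RM by blast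
    have "(- w2, - t2) \<in> M" using scale[OF w2(1), of "-1"] by simp
    then have lo: "- t2 \<in> lo" unfolding lo_def using w2(2) by (auto intro!: exI[of _ "- w2"] simp: add.commute)
    have bdd: "bdd_above lo" unfolding lo_def using le w1 by (intro bdd_aboveI[of _ t1]) blast
    define t0 where "t0 = Sup lo"
    have below: "s \<le> t0" if "(w, s) \<in> M" "v - w \<in> C" for w s
      unfolding t0_def using that bdd by (intro cSup_upper) (auto simp: lo_def)
    have above: "t0 \<le> s" if "(w, s) \<in> M" "w - v \<in> C" for w s
      unfolding t0_def using that lo le by (intro cSup_least) (auto simp: lo_def)
    define X where "X = {(w + c *\<^sub>R v, t + c * t0) | w c t. (w, t) \<in> M}"
    have "subspace X"
    proof (rule subspaceI)
      show "0 \<in> X" unfolding X_def using subspace_0[OF sM] by (force simp: zero_prod_def)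
    next
      fix x y assume "x \<in> X" "y \<in> X"
      then obtain w c t w' c' t' where *: "x = (w + c *\<^sub>R v, t + c * t0)" "(w, t) \<in> M"
        "y = (w' + c' *\<^sub>R v, t' + c' * t0)" "(w', t') \<in> M" unfolding X_def by blast
      have "x + y = ((w + w') + (c + c') *\<^sub>R v, (t + t') + (c + c') * t0)"
        using * by (simp add: algebra_simps)
      then show "x + y \<in> X" unfolding X_def using add[OF *(2,4)] by blast
    next
      fix a x assume "x \<in> X"
      then obtain w c t where *: "x = (w + c *\<^sub>R v, t + c * t0)" "(w, t) \<in> M" unfolding X_def by blast
      have "a *\<^sub>R x = (a *\<^sub>R w + (a * c) *\<^sub>R v, a * t + (a * c) * t0)"
        using * by (simp add: algebra_simps)
      then show "a *\<^sub>R x \<in> X" unfolding X_def using scale[OF *(2)] by blast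
    qed
    moreover have MX: "M \<subseteq> X"
    proof
      fix x assume "x \<in> M"
      moreover obtain w t where "x = (w, t)" by (cases x)
      ultimately have "x = (w + 0 *\<^sub>R v, t + 0 * t0) \<and> (w, t) \<in> M" by simp
      then show "x \<in> X" unfolding X_def by blast
    qed
    moreover have "X \<subseteq> V \<times> UNIV"
      unfolding X_def using MV v V by (auto intro!: subspace_add subspace_scale)
    moreover have "0 \<le> s" if us: "(u, s) \<in> X" "u \<in> C" for u s
    proof -
      obtain w c t where *: "u = w + c *\<^sub>R v" "s = t + c * t0" "(w, t) \<in> M"
        using us unfolding X_def by blast
      \<comment> \<open>After division by \<open>\<bar>c\<bar>\<close>, membership of
        \<open>u\<close> in \<open>C\<close> says that \<open>v\<close> lies above
        (\<open>c > 0\<close>) or below (\<open>c < 0\<close>) a vector in the domain of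
        \<open>M\<close>; \<open>t0\<close> separates the two families of values.\<close>
      consider "c = 0" | "c > 0" | "c < 0" by linarith
      then show ?thesis
      proof cases
        case 1
        then show ?thesis using * us pM by simp
      next
        case 2
        have "(1 / c) *\<^sub>R u = v - (- 1 / c) *\<^sub>R w"
          using 2 * by (simp add: algebra_simps)
        then have "v - (- 1 / c) *\<^sub>R w \<in> C" using Cscale[OF _ us(2), of "1 / c"] 2 by simp
        from below[OF scale[OF *(3)] this] have "- (t / c) \<le> t0" by simp
        then show ?thesis using 2 * by (simp add: field_simps)
      next
        case 3
        have "(- 1 / c) *\<^sub>R u = (- 1 / c) *\<^sub>R w - v"
          using 3 * by (simp add: algebra_simps)
        then have "(- 1 / c) *\<^sub>R w - v \<in> C" using Cscale[OF _ us(2), of "- 1 / c"] 3 by simp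
        from above[OF scale[OF *(3)] this] have "t0 \<le> - (t / c)" by simp
        then show ?thesis using 3 * by (simp add: field_simps)
      qed
    qed
    ultimately have "X \<in> A" unfolding A_def using RM by blast
    then have "X = M" using maxi MX by blast
    moreover have "(v, t0) = (0 + 1 *\<^sub>R v, 0 + 1 * t0) \<and> (0, 0) \<in> M"
      using subspace_0[OF sM] by (simp add: zero_prod_def)
    then have "(v, t0) \<in> X" unfolding X_def by blast
    ultimately show ?thesis by blast
  qed
  define L where "L v = (THE t. (v, t) \<in> M)" for v
  have Leq: "L v = t" if "(v, t) \<in> M" for v t
    unfolding L_def using that unique by blast
  have LM: "(v, L v) \<in> M" if "v \<in> V" for v
    using total[OF that] Leq by blast
  show ?thesis
  proof (intro exI[of _ L] conjI ballI allI impI)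
    show "L (v + w) = L v + L w" if "v \<in> V" "w \<in> V" for v w
      using add[OF LM[OF that(1)] LM[OF that(2)]] by (rule Leq)
    show "L (c *\<^sub>R v) = c * L v" if "v \<in> V" for c v
      using scale[OF LM[OF that]] by (rule Leq)
    show "0 \<le> L v" if "v \<in> V" "v \<in> C" for v
      using pM LM that by blast
    show "L w = t" if "(w, t) \<in> R" for w t
      using Leq RM that by blast
  qed
qed

section \<open>Positive linear functionals on spaces of bounded continuous functions\<close>

definition positive_linear_on ::
  "('a::topological_space \<Rightarrow>\<^sub>C real) set \<Rightarrow> (('a \<Rightarrow>\<^sub>C real) \<Rightarrow> real) \<Rightarrow> bool"
  where "positive_linear_on V L \<longleftrightarrow> subspace V \<and>
    (\<forall>h\<in>V. \<forall>k\<in>V. L (h + k) = L h + L k) \<and>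
    (\<forall>h\<in>V. \<forall>c. L (c *\<^sub>R h) = c * L h) \<and>
    (\<forall>h\<in>V. (\<forall>x. 0 \<le> apply_bcontfun h x) \<longrightarrow> 0 \<le> L h)"

context
  fixes V :: "('a::topological_space \<Rightarrow>\<^sub>C real) set" and L
  assumes L: "positive_linear_on V L"
begin

lemma plin_subspace: "subspace V"
  using L by (simp add: positive_linear_on_def)

lemma plin_add: "h \<in> V \<Longrightarrow> k \<in> V \<Longrightarrow> L (h + k) = L h + L k"
  using L by (simp add: positive_linear_on_def)

lemma plin_scale: "h \<in> V \<Longrightarrow> L (c *\<^sub>R h) = c * L h"
  using L by (simp add: positive_linear_on_def)

lemma plin_nonneg: "h \<in> V \<Longrightarrow> (\<And>x. 0 \<le> apply_bcontfun h x) \<Longrightarrow> 0 \<le> L h"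
  using L by (simp add: positive_linear_on_def)

lemma plin_zero: "L 0 = 0"
  using plin_scale[OF subspace_0[OF plin_subspace], of 0] by simp

lemma plin_diff: "h \<in> V \<Longrightarrow> k \<in> V \<Longrightarrow> L (h - k) = L h - L k"
  using plin_add[of h "(-1) *\<^sub>R k"] plin_scale[of k "-1"] subspace_scale[OF plin_subspace, of k "-1"]
  by simp

lemma plin_sum: "(\<And>i. i \<in> A \<Longrightarrow> F i \<in> V) \<Longrightarrow> L (sum F A) = (\<Sum>i\<in>A. L (F i))"
  by (induction A rule: infinite_finite_induct)
    (auto simp: plin_zero plin_add subspace_sum[OF plin_subspace])

lemma plin_mono:
  assumes "h \<in> V" "k \<in> V" "\<And>x. apply_bcontfun h x \<le> apply_bcontfun k x"
  shows "L h \<le> L k"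
  using plin_nonneg[OF subspace_diff[OF plin_subspace assms(2,1)]] assms plin_diff[OF assms(2,1)]
  by simp

lemma plin_abs_le:
  assumes "h \<in> V" "k \<in> V" "\<And>x. \<bar>apply_bcontfun h x\<bar> \<le> apply_bcontfun k x"
  shows "\<bar>L h\<bar> \<le> L k"
proof -
  have "L ((-1) *\<^sub>R h) \<le> L k"
    using assms by (intro plin_mono subspace_scale[OF plin_subspace]) (auto simp: abs_le_iff)
  moreover have "L h \<le> L k" using assms by (intro plin_mono) (auto simp: abs_le_iff)
  ultimately show ?thesis using plin_scale[OF assms(1), of "-1"] by (simp add: abs_le_iff)
qed

end

lemma positive_linear_on_subset:
  "positive_linear_on V L \<Longrightarrow> subspace W \<Longrightarrow> W \<subseteq> V \<Longrightarrow> positive_linear_on W L"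
  unfolding positive_linear_on_def by blast

lemma positive_extension_bcontfun:
  fixes V :: "('a::topological_space \<Rightarrow>\<^sub>C real) set"
  assumes "subspace V" "subspace R" "R \<subseteq> V \<times> UNIV"
    and "\<And>w t. (w, t) \<in> R \<Longrightarrow> (\<And>x. 0 \<le> apply_bcontfun w x) \<Longrightarrow> 0 \<le> t"
    and "\<And>v. v \<in> V \<Longrightarrow> \<exists>w t. (w, t) \<in> R \<and> (\<forall>x. apply_bcontfun v x \<le> apply_bcontfun w x)"
  obtains L where "positive_linear_on V L" "\<And>w t. (w, t) \<in> R \<Longrightarrow> L w = t"
proof -
  let ?C = "{h :: 'a \<Rightarrow>\<^sub>C real. \<forall>x. 0 \<le> apply_bcontfun h x}"
  have "\<exists>L. (\<forall>v\<in>V. \<forall>w\<in>V. L (v + w) = L v + L w) \<and> (\<forall>v\<in>V. \<forall>c. L (c *\<^sub>R v) = c * L v) \<and>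
    (\<forall>v\<in>V. v \<in> ?C \<longrightarrow> 0 \<le> L v) \<and> (\<forall>w t. (w, t) \<in> R \<longrightarrow> L w = t)"
    by (rule positive_extension) (use assms in auto)
  then show thesis using that assms(1) unfolding positive_linear_on_def by auto
qed

text \<open>The relation to be extended is the span of the pairs \<open>(ltrans g f, 1)\<close>. The
  translate property at \<open>f\<close> is exactly its positivity, and it is cofinal because every
  dominated function lies below a sum of translates of \<open>f\<close>. Linear dependencies among
  the translates require no separate treatment.\<close>

lemma translate_functional:
  fixes f :: "'a::topological_group_add \<Rightarrow>\<^sub>C real"
  assumes tp: "translate_property (Cb_ru :: ('a \<Rightarrow>\<^sub>C real) set)"
    and f: "f \<in> Cb_ru" "f \<noteq> 0" and nonneg: "\<And>x. 0 \<le> apply_bcontfun f x"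
  obtains L where "positive_linear_on (dominated_by_translates Cb_ru f) L"
    and "\<And>g. L (ltrans g f) = 1"
proof -
  let ?V = "dominated_by_translates Cb_ru f"
  let ?S = "range (\<lambda>g. (ltrans g f, 1::real))"
  have fV: "f \<in> ?V" using f nonneg by (intro self_dominated)
  have V: "subspace ?V" using nonneg by (rule subspace_dominated)
  \<comment> \<open>The translate property speaks of sums over \<open>j < n\<close>, so elements of
    the span are brought into this form; a new term is appended at index \<open>n\<close>.\<close>
  have rep: "\<exists>n t (g :: nat \<Rightarrow> 'a). fst p = (\<Sum>j<n. t j *\<^sub>R ltrans (g j) f) \<and> snd p = (\<Sum>j<n. t j)"
    if "p \<in> span ?S" for p
    using that
  proof (induction rule: span_induct_alt)
    case base
    show ?case by (auto intro!: exI[of _ 0])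
  next
    case (step c x y)
    then obtain n t and g :: "nat \<Rightarrow> 'a" and h
      where *: "fst y = (\<Sum>j<n. t j *\<^sub>R ltrans (g j) f)" "snd y = (\<Sum>j<n. t j)"
        "x = (ltrans h f, 1)" by blast
    show ?case
      by (intro exI[of _ "Suc n"] exI[of _ "t(n := c)"] exI[of _ "g(n := h)"])
        (simp add: * add.commute)
  qed
  have "span ?S \<subseteq> ?V \<times> UNIV"
    using V fV by (intro span_minimal subspace_Times) (auto intro: ltrans_dominated)
  moreover have "0 \<le> t" if wt: "(w, t) \<in> span ?S" "\<And>x. 0 \<le> apply_bcontfun w x" for w t
  proof -
    obtain n u and g :: "nat \<Rightarrow> 'a"
      where *: "w = (\<Sum>j<n. u j *\<^sub>R ltrans (g j) f)" "t = (\<Sum>j<n. u j)"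
      using rep[OF wt(1)] by auto
    have "\<forall>x. 0 \<le> apply_bcontfun (\<Sum>j<n. u j *\<^sub>R ltrans (g j) f) x"
      using wt(2) * by simp
    then show ?thesis
      using tp f nonneg unfolding translate_property_def *(2) by blast
  qed
  moreover have "\<exists>w t. (w, t) \<in> span ?S \<and> (\<forall>x. apply_bcontfun v x \<le> apply_bcontfun w x)" if v: "v \<in> ?V" for v
  proof -
    obtain n and g :: "nat \<Rightarrow> 'a" where g: "\<And>x. \<bar>apply_bcontfun v x\<bar> \<le> apply_bcontfun (\<Sum>j<n. ltrans (g j) f) x"
      using v unfolding dominated_by_translates_def by blast
    have "(\<Sum>j<n. (ltrans (g j) f, 1::real)) \<in> span ?S"
      by (intro span_sum span_base) auto
    then have "(\<Sum>j<n. ltrans (g j) f, real n) \<in> span ?S"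
      by (simp add: sum_prod)
    then show ?thesis using g by (meson abs_le_D1)
  qed
  ultimately obtain L where L: "positive_linear_on ?V L" "\<And>w t. (w, t) \<in> span ?S \<Longrightarrow> L w = t"
    by (rule positive_extension_bcontfun[OF V subspace_span]) blast+
  have "L (ltrans g f) = 1" for g
    by (intro L(2) span_base) auto
  with L(1) show thesis by (rule that)
qed

subsection \<open>Uniform continuity and domination\<close>

lemma apply_ltrans [simp]: "apply_bcontfun (ltrans g f) x = apply_bcontfun f (- g + x)"
  by (simp add: ltrans.rep_eq)

lemma ltrans_diff: "ltrans g (f - h) = ltrans g f - ltrans g h"
  by (rule bcontfun_eqI) simp

lemma Cb_ru_oscillation:
  assumes "h \<in> Cb_ru" "0 < e"
  shows "\<forall>\<^sub>F u in nhds 0. \<forall>x. \<bar>apply_bcontfun h (- u + x) - apply_bcontfun h x\<bar> \<le> e"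
proof -
  have "\<forall>a. ((\<lambda>g. ltrans g h) \<longlongrightarrow> ltrans a h) (nhds a)"
    using assms(1) unfolding Cb_ru_def continuous_on_def by (auto simp: tendsto_at_iff_tendsto_nhds[of "\<lambda>g. ltrans g h"])
  then have "((\<lambda>g. ltrans g h) \<longlongrightarrow> ltrans 0 h) (nhds 0)" by (rule spec)
  then have "\<forall>\<^sub>F g in nhds 0. dist (ltrans g h) (ltrans 0 h) < e"
    using assms(2) by (rule tendstoD)
  then show ?thesis
  proof eventually_elim
    case (elim u)
    show ?case
    proof
      fix x
      have "dist (apply_bcontfun (ltrans u h) x) (apply_bcontfun (ltrans 0 h) x) < e"
        using elim dist_bounded le_less_trans by blast
      then show "\<bar>apply_bcontfun h (- u + x) - apply_bcontfun h x\<bar> \<le> e"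
        by (simp add: dist_real_def)
    qed
  qed
qed

text \<open>Small oscillation at the identity is enough: \<open>z = - (x - z) + x\<close> turns it
  into continuity of \<open>F\<close> at \<open>x\<close>, and translation by \<open>- a + g\<close>
  carries it to continuity of the orbit at an arbitrary \<open>a\<close>.\<close>

lemma Cb_ru_obtain:
  fixes F :: "'a::topological_group_add \<Rightarrow> real"
  assumes bound: "\<And>x. \<bar>F x\<bar> \<le> B"
    and osc: "\<And>e. 0 < e \<Longrightarrow> \<forall>\<^sub>F u in nhds 0. \<forall>x. \<bar>F (- u + x) - F x\<bar> \<le> e"
  obtains h where "h \<in> Cb_ru" "\<And>x. apply_bcontfun h x = F x"
proof -
  have osc': "\<forall>\<^sub>F u in nhds 0. \<forall>x. \<bar>F (- u + x) - F x\<bar> < e" if "0 < e" for e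
  proof -
    have "\<forall>\<^sub>F u in nhds 0. \<forall>x. \<bar>F (- u + x) - F x\<bar> \<le> e / 2"
      using that by (intro osc) simp
    then show ?thesis
    proof eventually_elim
      case (elim u)
      have "e / 2 < e" using that by simp
      then show ?case using elim le_less_trans by blast
    qed
  qed
  have "(F \<longlongrightarrow> F x) (nhds x)" for x
  proof (rule tendstoI)
    fix e :: real assume e: "0 < e"
    have "((\<lambda>z. x - z) \<longlongrightarrow> x - x) (nhds x)"
      by (intro tendsto_intros) (simp add: filterlim_ident)
    then have "filterlim (\<lambda>z. x - z) (nhds 0) (nhds x)" by simp
    from eventually_compose_filterlim[OF osc'[OF e] this]
    have "\<forall>\<^sub>F z in nhds x. \<forall>y. \<bar>F (- (x - z) + y) - F y\<bar> < e" .
    then show "\<forall>\<^sub>F z in nhds x. dist (F z) (F x) < e"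
    proof eventually_elim
      case (elim z)
      then show ?case using elim[rule_format, of x] by (simp add: dist_real_def)
    qed
  qed
  then have "continuous_on UNIV F"
    by (simp add: continuous_on_def tendsto_at_iff_tendsto_nhds[of F])
  then have "F \<in> bcontfun" using bound by (intro bcontfun_normI[of _ B]) auto
  then obtain h where h: "F = apply_bcontfun h" by (rule bcontfunE)
  have "((\<lambda>g. ltrans g h) \<longlongrightarrow> ltrans a h) (nhds a)" for a
  proof (rule tendstoI)
    fix e :: real assume e: "0 < e"
    have "((\<lambda>g. - a + g) \<longlongrightarrow> - a + a) (nhds a)"
      by (intro tendsto_intros) (simp add: filterlim_ident)
    then have lim: "filterlim (\<lambda>g. - a + g) (nhds 0) (nhds a)" by simp
    have "\<forall>\<^sub>F g in nhds a. \<forall>y. \<bar>F (- (- a + g) + y) - F y\<bar> \<le> e / 2"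
      using e by (intro eventually_compose_filterlim[OF osc lim]) simp
    then show "\<forall>\<^sub>F g in nhds a. dist (ltrans g h) (ltrans a h) < e"
    proof eventually_elim
      case (elim g)
      have "dist (apply_bcontfun (ltrans g h) x) (apply_bcontfun (ltrans a h) x) \<le> e / 2" for x
        using elim[rule_format, of "- a + x"]
        by (simp add: h dist_real_def minus_add add.assoc del: add_uminus_conv_diff)
      then have "dist (ltrans g h) (ltrans a h) \<le> e / 2" by (rule dist_bound)
      then show ?case using e by simp
    qed
  qed
  then have "h \<in> Cb_ru"
    unfolding Cb_ru_def by (simp add: continuous_on_def tendsto_at_iff_tendsto_nhds[of "\<lambda>g. ltrans g h"])
  then show thesis using that h by simp
qed

lemma dominated_mono:
  assumes "h \<in> Cb_ru" "k \<in> dominated_by_translates Cb_ru f"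
    and "\<And>x. \<bar>apply_bcontfun h x\<bar> \<le> \<bar>apply_bcontfun k x\<bar>"
  shows "h \<in> dominated_by_translates Cb_ru f"
  using assms order_trans unfolding dominated_by_translates_def by blast

lemma dominated_obtain:
  assumes "f \<in> Cb_ru" "\<And>x. 0 \<le> apply_bcontfun f x" "h \<in> dominated_by_translates Cb_ru f"
  obtains n and g :: "nat \<Rightarrow> 'a::topological_group_add"
  where "(\<Sum>j<n. ltrans (g j) f) \<in> dominated_by_translates Cb_ru f"
    "\<And>x. \<bar>apply_bcontfun h x\<bar> \<le> apply_bcontfun (\<Sum>j<n. ltrans (g j) f) x"
proof -
  obtain n and g :: "nat \<Rightarrow> 'a" where "\<forall>x. \<bar>apply_bcontfun h x\<bar> \<le> apply_bcontfun (\<Sum>j<n. ltrans (g j) f) x"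
    using assms(3) unfolding dominated_by_translates_def by blast
  moreover have "(\<Sum>j<n. ltrans (g j) f) \<in> dominated_by_translates Cb_ru f"
    using assms(1,2) by (intro subspace_sum[OF subspace_dominated] ltrans_dominated self_dominated) auto
  ultimately show thesis using that by blast
qed

text \<open>Uniform continuity with the constant 1 replaced by a weight \<open>P\<close>, in the
  manner of relatively uniform convergence in ordered spaces. For \<open>P = 1\<close> it is the
  oscillation estimate in the supremum norm.\<close>

definition dominated_oscillation :: "('a::topological_group_add \<Rightarrow>\<^sub>C real) \<Rightarrow> ('a \<Rightarrow>\<^sub>C real) \<Rightarrow> bool"
  where "dominated_oscillation h P \<longleftrightarrow>
    (\<forall>e>0. \<forall>\<^sub>F u in nhds 0. \<forall>x. \<bar>apply_bcontfun h (- u + x) - apply_bcontfun h x\<bar> \<le> e * apply_bcontfun P x)"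

text \<open>On these functions the orbit map of a suitable functional takes values in
  \<open>Cb_ru\<close>. The weight has to be dominated by translates of \<open>f\<close> so that the
  functional controls it.\<close>

definition uniformly_dominated :: "('a::topological_group_add \<Rightarrow>\<^sub>C real) \<Rightarrow> ('a \<Rightarrow>\<^sub>C real) set"
  where "uniformly_dominated f =
    {h \<in> dominated_by_translates Cb_ru f. \<exists>P\<in>dominated_by_translates Cb_ru f. dominated_oscillation h P}"

text \<open>The filter \<open>nhds 0\<close> includes the point \<open>u = 0\<close>, where the left
  side of the estimate vanishes.\<close>

lemma dominated_oscillation_nonneg:
  assumes "dominated_oscillation h P" shows "0 \<le> apply_bcontfun P x"
proof -
  have "\<forall>\<^sub>F u in nhds 0. \<forall>x. \<bar>apply_bcontfun h (- u + x) - apply_bcontfun h x\<bar> \<le> 1 * apply_bcontfun P x"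
    using assms unfolding dominated_oscillation_def by (meson zero_less_one)
  from eventually_nhds_x_imp_x[OF this] show ?thesis
    by (auto dest!: spec[of _ x])
qed

lemma dominated_oscillation_add:
  assumes "dominated_oscillation h P" "dominated_oscillation k Q"
  shows "dominated_oscillation (h + k) (P + Q)"
  unfolding dominated_oscillation_def
proof (intro allI impI)
  fix e :: real assume e: "0 < e"
  have "\<forall>\<^sub>F u in nhds 0. \<forall>x. \<bar>apply_bcontfun h (- u + x) - apply_bcontfun h x\<bar> \<le> e * apply_bcontfun P x"
    "\<forall>\<^sub>F u in nhds 0. \<forall>x. \<bar>apply_bcontfun k (- u + x) - apply_bcontfun k x\<bar> \<le> e * apply_bcontfun Q x"
    using assms e unfolding dominated_oscillation_def by auto
  then show "\<forall>\<^sub>F u in nhds 0. \<forall>x. \<bar>apply_bcontfun (h + k) (- u + x) - apply_bcontfun (h + k) x\<bar> \<le> e * apply_bcontfun (P + Q) x"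
  proof eventually_elim
    case (elim u)
    show ?case
    proof
      fix x
      show "\<bar>apply_bcontfun (h + k) (- u + x) - apply_bcontfun (h + k) x\<bar> \<le> e * apply_bcontfun (P + Q) x"
        using elim(1)[rule_format, of x] elim(2)[rule_format, of x] by (simp add: distrib_left)
    qed
  qed
qed

lemma dominated_oscillation_scaleR:
  assumes "dominated_oscillation h P"
  shows "dominated_oscillation (c *\<^sub>R h) (\<bar>c\<bar> *\<^sub>R P)"
  unfolding dominated_oscillation_def
proof (intro allI impI)
  fix e :: real assume "0 < e"
  then have "\<forall>\<^sub>F u in nhds 0. \<forall>x. \<bar>apply_bcontfun h (- u + x) - apply_bcontfun h x\<bar> \<le> e * apply_bcontfun P x"
    using assms unfolding dominated_oscillation_def by auto
  then show "\<forall>\<^sub>F u in nhds 0. \<forall>x. \<bar>apply_bcontfun (c *\<^sub>R h) (- u + x) - apply_bcontfun (c *\<^sub>R h) x\<bar> \<le> e * apply_bcontfun (\<bar>c\<bar> *\<^sub>R P) x"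
  proof eventually_elim
    case (elim u)
    show ?case
    proof
      fix x
      have "\<bar>c\<bar> * \<bar>apply_bcontfun h (- u + x) - apply_bcontfun h x\<bar> \<le> \<bar>c\<bar> * (e * apply_bcontfun P x)"
        using elim by (intro mult_left_mono) auto
      then show "\<bar>apply_bcontfun (c *\<^sub>R h) (- u + x) - apply_bcontfun (c *\<^sub>R h) x\<bar> \<le> e * apply_bcontfun (\<bar>c\<bar> *\<^sub>R P) x"
        by (simp add: mult.left_commute flip: abs_mult right_diff_distrib)
    qed
  qed
qed

text \<open>Translating by \<open>g\<close> replaces \<open>u\<close> by its conjugate
  \<open>- g + u + g\<close>, which still tends to 0.\<close>

lemma dominated_oscillation_ltrans:
  assumes "dominated_oscillation h P"
  shows "dominated_oscillation (ltrans g h) (ltrans g P)"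
  unfolding dominated_oscillation_def
proof (intro allI impI)
  fix e :: real assume "0 < e"
  then have *: "\<forall>\<^sub>F u in nhds 0. \<forall>x. \<bar>apply_bcontfun h (- u + x) - apply_bcontfun h x\<bar> \<le> e * apply_bcontfun P x"
    using assms unfolding dominated_oscillation_def by auto
  have "((\<lambda>u. - g + u + g) \<longlongrightarrow> - g + 0 + g) (nhds 0)"
    by (intro tendsto_intros) (simp add: filterlim_ident)
  then have "filterlim (\<lambda>u. - g + u + g) (nhds 0) (nhds 0)" by simp
  from eventually_compose_filterlim[OF * this]
  have "\<forall>\<^sub>F u in nhds 0. \<forall>x. \<bar>apply_bcontfun h (- (- g + u + g) + x) - apply_bcontfun h x\<bar> \<le> e * apply_bcontfun P x" .
  then show "\<forall>\<^sub>F u in nhds 0. \<forall>x. \<bar>apply_bcontfun (ltrans g h) (- u + x) - apply_bcontfun (ltrans g h) x\<bar> \<le> e * apply_bcontfun (ltrans g P) x"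
  proof eventually_elim
    case (elim u)
    show ?case
    proof
      fix x
      show "\<bar>apply_bcontfun (ltrans g h) (- u + x) - apply_bcontfun (ltrans g h) x\<bar> \<le> e * apply_bcontfun (ltrans g P) x"
        using elim[rule_format, of "- g + x"] by (simp add: minus_add add.assoc del: add_uminus_conv_diff)
    qed
  qed
qed

lemma uniformly_dominated_dominated: "h \<in> uniformly_dominated f \<Longrightarrow> h \<in> dominated_by_translates Cb_ru f"
  by (simp add: uniformly_dominated_def)

lemma ltrans_uniformly_dominated: "h \<in> uniformly_dominated f \<Longrightarrow> ltrans g h \<in> uniformly_dominated f"
  unfolding uniformly_dominated_def using dominated_oscillation_ltrans ltrans_dominated by blast

lemma subspace_uniformly_dominated:
  assumes "\<And>x. 0 \<le> apply_bcontfun f x"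
  shows "subspace (uniformly_dominated f)"
proof (rule subspaceI)
  have V: "subspace (dominated_by_translates Cb_ru f)" using assms by (rule subspace_dominated)
  have "dominated_oscillation (0 :: 'a \<Rightarrow>\<^sub>C real) 0" by (simp add: dominated_oscillation_def)
  then show "0 \<in> uniformly_dominated f"
    unfolding uniformly_dominated_def using subspace_0[OF V] by blast
  show "h + k \<in> uniformly_dominated f" if "h \<in> uniformly_dominated f" "k \<in> uniformly_dominated f" for h k
    using that dominated_oscillation_add subspace_add[OF V] unfolding uniformly_dominated_def by blast
  show "c *\<^sub>R h \<in> uniformly_dominated f" if "h \<in> uniformly_dominated f" for c h
    using that dominated_oscillation_scaleR subspace_scale[OF V] unfolding uniformly_dominated_def by blast
qed

subsection \<open>Orbit maps\<close>

text \<open>The sign in \<open>- x\<close> makes the map commute with left translations. The value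
  of \<open>Bcontfun\<close> is meaningful only for a bounded continuous argument, which is
  established for uniformly dominated \<open>h\<close>.\<close>

definition orbit_map :: "(('a::topological_group_add \<Rightarrow>\<^sub>C real) \<Rightarrow> real) \<Rightarrow> ('a \<Rightarrow>\<^sub>C real) \<Rightarrow> 'a \<Rightarrow>\<^sub>C real"
  where "orbit_map L h = Bcontfun (\<lambda>x. L (ltrans (- x) h))"

context
  fixes f :: "'a::topological_group_add \<Rightarrow>\<^sub>C real" and L
  assumes f: "f \<in> Cb_ru" and nonneg: "\<And>x. 0 \<le> apply_bcontfun f x"
    and L: "positive_linear_on (dominated_by_translates Cb_ru f) L"
    and norm1: "\<And>g. L (ltrans g f) = 1"
begin

text \<open>On every translate of a dominating sum of \<open>n\<close> translates of
  \<open>f\<close>, the functional \<open>L\<close> has the value \<open>n\<close>.\<close>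

lemma orbit_bounded:
  assumes "h \<in> dominated_by_translates Cb_ru f"
  obtains n :: nat where "\<And>g. \<bar>L (ltrans g h)\<bar> \<le> real n"
proof -
  obtain n and a :: "nat \<Rightarrow> 'a" where a: "(\<Sum>j<n. ltrans (a j) f) \<in> dominated_by_translates Cb_ru f"
    "\<And>x. \<bar>apply_bcontfun h x\<bar> \<le> apply_bcontfun (\<Sum>j<n. ltrans (a j) f) x"
    using dominated_obtain[OF f nonneg assms] by blast
  have "\<bar>L (ltrans g h)\<bar> \<le> real n" for g
  proof -
    have "\<bar>L (ltrans g h)\<bar> \<le> L (ltrans g (\<Sum>j<n. ltrans (a j) f))"
      by (rule plin_abs_le[OF L ltrans_dominated[OF assms] ltrans_dominated[OF a(1)]]) (simp add: a(2))
    also have "\<dots> = (\<Sum>j<n. L (ltrans (g + a j) f))"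
      unfolding ltrans_sum ltrans_ltrans
      by (rule plin_sum[OF L]) (intro ltrans_dominated self_dominated f nonneg)
    finally show ?thesis by (simp add: norm1)
  qed
  then show thesis by (rule that)
qed

text \<open>Passing from \<open>x\<close> to \<open>- u + x\<close> changes the value by
  \<open>L\<close> of a translate of \<open>ltrans u h - h\<close>. This function is dominated by a
  small multiple of \<open>P\<close>, and \<open>L\<close> is bounded on the orbit of
  \<open>P\<close>. A bound by a small constant would not do, since constants need not be dominated
  by translates of \<open>f\<close>.\<close>

lemma
  assumes h: "h \<in> uniformly_dominated f"
  shows orbit_map_Cb_ru: "orbit_map L h \<in> Cb_ru" and apply_orbit_map: "apply_bcontfun (orbit_map L h) x = L (ltrans (- x) h)"
proof -
  obtain P where hV: "h \<in> dominated_by_translates Cb_ru f" and P: "P \<in> dominated_by_translates Cb_ru f"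
    and osc: "dominated_oscillation h P"
    using h unfolding uniformly_dominated_def by blast
  have V: "subspace (dominated_by_translates Cb_ru f)" by (rule plin_subspace[OF L])
  obtain m :: nat where m: "\<And>g. \<bar>L (ltrans g h)\<bar> \<le> real m" using orbit_bounded[OF hV] by blast
  obtain n :: nat where n: "\<And>g. \<bar>L (ltrans g P)\<bar> \<le> real n" using orbit_bounded[OF P] by blast
  have "\<forall>\<^sub>F u in nhds 0. \<forall>x. \<bar>L (ltrans (- (- u + x)) h) - L (ltrans (- x) h)\<bar> \<le> e" if e: "0 < e" for e
  proof -
    have "\<forall>\<^sub>F u in nhds 0. \<forall>x. \<bar>apply_bcontfun h (- u + x) - apply_bcontfun h x\<bar> \<le> e / (real n + 1) * apply_bcontfun P x"
      using osc[unfolded dominated_oscillation_def, rule_format, of "e / (real n + 1)"] e by simp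
    then show ?thesis
    proof eventually_elim
      case (elim u)
      show ?case
      proof
        fix x
        have "L (ltrans (- (- u + x)) h) - L (ltrans (- x) h) = L (ltrans (- x) (ltrans u h - h))"
          by (subst plin_diff[OF L, symmetric])
            (simp_all add: hV ltrans_dominated ltrans_diff ltrans_ltrans minus_add del: add_uminus_conv_diff)
        also have "\<bar>\<dots>\<bar> \<le> L (ltrans (- x) ((e / (real n + 1)) *\<^sub>R P))"
          by (rule plin_abs_le[OF L])
            (use elim in \<open>auto intro!: ltrans_dominated subspace_diff[OF V] subspace_scale[OF V] hV P\<close>)
        also have "\<dots> = e / (real n + 1) * L (ltrans (- x) P)"
          by (simp add: ltrans_scaleR plin_scale[OF L] ltrans_dominated P)
        also have "\<dots> \<le> e / (real n + 1) * (real n + 1)"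
          using n[of "- x"] e by (intro mult_left_mono) auto
        finally show "\<bar>L (ltrans (- (- u + x)) h) - L (ltrans (- x) h)\<bar> \<le> e" using e by simp
      qed
    qed
  qed
  then obtain k where k: "k \<in> Cb_ru" "\<And>x. apply_bcontfun k x = L (ltrans (- x) h)"
    using Cb_ru_obtain[of "\<lambda>x. L (ltrans (- x) h)" "real m"] m by blast
  have "orbit_map L h = k" unfolding orbit_map_def k(2)[symmetric] by (simp add: apply_bcontfun_inverse)
  then show "orbit_map L h \<in> Cb_ru" "apply_bcontfun (orbit_map L h) x = L (ltrans (- x) h)"
    using k by simp_all
qed

lemma orbit_map_ltrans:
  assumes "h \<in> uniformly_dominated f"
  shows "orbit_map L (ltrans g h) = ltrans g (orbit_map L h)"
  by (rule bcontfun_eqI)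
    (simp add: apply_orbit_map assms ltrans_uniformly_dominated ltrans_ltrans minus_add del: add_uminus_conv_diff)

lemma positive_linear_on_orbit_map:
  assumes M: "positive_linear_on Cb_ru M"
  shows "positive_linear_on (uniformly_dominated f) (\<lambda>h. M (orbit_map L h))"
proof -
  have W: "subspace (uniformly_dominated f)" using nonneg by (rule subspace_uniformly_dominated)
  have "orbit_map L (h + k) = orbit_map L h + orbit_map L k"
    if "h \<in> uniformly_dominated f" "k \<in> uniformly_dominated f" for h k
    using that by (intro bcontfun_eqI)
      (simp add: apply_orbit_map subspace_add[OF W] ltrans_add plin_add[OF L] ltrans_dominated uniformly_dominated_dominated)
  moreover have "orbit_map L (c *\<^sub>R h) = c *\<^sub>R orbit_map L h"
    if "h \<in> uniformly_dominated f" for h c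
    using that by (intro bcontfun_eqI)
      (simp add: apply_orbit_map subspace_scale[OF W] ltrans_scaleR plin_scale[OF L] ltrans_dominated uniformly_dominated_dominated)
  moreover have "0 \<le> M (orbit_map L h)"
    if "h \<in> uniformly_dominated f" "\<And>x. 0 \<le> apply_bcontfun h x" for h
    using that by (intro plin_nonneg[OF M] orbit_map_Cb_ru)
      (auto simp: apply_orbit_map intro!: plin_nonneg[OF L] ltrans_dominated dest: uniformly_dominated_dominated)
  ultimately show ?thesis
    unfolding positive_linear_on_def
    using W plin_add[OF M] plin_scale[OF M] orbit_map_Cb_ru by auto
qed

end

subsection \<open>Invariant means\<close>

abbreviation one_bcontfun :: "'a::topological_space \<Rightarrow>\<^sub>C real" where "one_bcontfun \<equiv> const_bcontfun 1"

lemma ltrans_one [simp]: "ltrans g one_bcontfun = one_bcontfun"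
  by (rule bcontfun_eqI) simp

lemma one_Cb_ru: "one_bcontfun \<in> Cb_ru"
  by (simp add: Cb_ru_def)

lemma dominated_eq_Cb_ru:
  fixes k :: "'a::topological_group_add \<Rightarrow>\<^sub>C real"
  assumes k: "k \<in> Cb_ru" "\<And>x. 1 \<le> apply_bcontfun k x"
  shows "dominated_by_translates Cb_ru k = Cb_ru"
proof
  have nonneg: "\<And>x. 0 \<le> apply_bcontfun k x" using k(2) order_trans zero_le_one by blast
  show "Cb_ru \<subseteq> dominated_by_translates Cb_ru k"
  proof
    fix h :: "'a \<Rightarrow>\<^sub>C real" assume h: "h \<in> Cb_ru"
    have "norm h *\<^sub>R k \<in> dominated_by_translates Cb_ru k"
      using k(1) nonneg by (intro subspace_scale[OF subspace_dominated] self_dominated)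
    moreover have "\<bar>apply_bcontfun h x\<bar> \<le> \<bar>apply_bcontfun (norm h *\<^sub>R k) x\<bar>" for x
      using norm_bounded[of h x] mult_left_mono[OF k(2)[of x], of "norm h"] nonneg[of x]
      by (simp add: abs_mult)
    ultimately show "h \<in> dominated_by_translates Cb_ru k" using h by (rule dominated_mono[rotated])
  qed
qed (auto simp: dominated_by_translates_def)

text \<open>With weight 1, dominated oscillation is oscillation in the supremum norm. Hence the
  results on orbit maps apply to means on all of \<open>Cb_ru\<close>.\<close>

lemma uniformly_dominated_one:
  "uniformly_dominated (one_bcontfun :: 'a::topological_group_add \<Rightarrow>\<^sub>C real) = Cb_ru"
proof -
  have "dominated_oscillation h one_bcontfun" if "h \<in> Cb_ru" for h :: "'a \<Rightarrow>\<^sub>C real"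
    unfolding dominated_oscillation_def using Cb_ru_oscillation[OF that] by simp
  moreover have V: "dominated_by_translates Cb_ru (one_bcontfun :: 'a \<Rightarrow>\<^sub>C real) = Cb_ru"
    by (rule dominated_eq_Cb_ru[OF one_Cb_ru]) simp
  ultimately show ?thesis
    unfolding uniformly_dominated_def V using one_Cb_ru by blast
qed

definition mean_on_Cb_ru :: "(('a::topological_group_add \<Rightarrow>\<^sub>C real) \<Rightarrow> real) \<Rightarrow> bool"
  where "mean_on_Cb_ru M \<longleftrightarrow> positive_linear_on Cb_ru M \<and> M one_bcontfun = 1"

text \<open>A functional with value 1 on the whole orbit of a shift of \<open>h\<close> by a
  constant is constant on the orbit of \<open>h\<close>, because translations fix constants.
  Dividing by its value at the constant 1 gives a mean.\<close>

lemma mean_invariant_on_one: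
  fixes h :: "'a::topological_group_add \<Rightarrow>\<^sub>C real"
  assumes tp: "translate_property (Cb_ru :: ('a \<Rightarrow>\<^sub>C real) set)"
    and h: "h \<in> Cb_ru"
  obtains M where "mean_on_Cb_ru M" "\<And>g. M (ltrans g h) = M h"
proof -
  let ?one = "one_bcontfun :: 'a \<Rightarrow>\<^sub>C real"
  \<comment> \<open>\<open>k\<close> lies between 1 and \<open>2 * norm h + 1\<close>. The lower
    bound makes all of \<open>Cb_ru\<close> dominated by translates of \<open>k\<close>; the upper
    bound makes \<open>L\<close> positive at the constant 1.\<close>
  define k where "k = h + (norm h + 1) *\<^sub>R ?one"
  have k1: "1 \<le> apply_bcontfun k x" and k2: "apply_bcontfun k x \<le> 2 * norm h + 1" for x
    using norm_bounded[of h x] by (auto simp: k_def)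
  have kC: "k \<in> Cb_ru"
    unfolding k_def by (intro subspace_add[OF subspace_Cb_ru] subspace_scale[OF subspace_Cb_ru] h one_Cb_ru)
  have "k \<noteq> 0" using k1[of 0] by auto
  moreover have "0 \<le> apply_bcontfun k x" for x using k1[of x] by linarith
  ultimately obtain L where "positive_linear_on (dominated_by_translates Cb_ru k) L" and Lk: "\<And>g. L (ltrans g k) = 1"
    using translate_functional[OF tp kC] by blast
  then have L: "positive_linear_on Cb_ru L" using dominated_eq_Cb_ru[OF kC k1] by simp
  define a where "a = L ?one"
  have "L k \<le> L ((2 * norm h + 1) *\<^sub>R ?one)"
    by (rule plin_mono[OF L kC]) (auto intro: subspace_scale[OF subspace_Cb_ru] one_Cb_ru simp: k2)
  then have "1 \<le> (2 * norm h + 1) * a"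
    using Lk[of 0] by (simp add: plin_scale[OF L one_Cb_ru] a_def ltrans_zero)
  moreover have "0 \<le> a" unfolding a_def by (rule plin_nonneg[OF L one_Cb_ru]) simp
  ultimately have a: "0 < a" by (cases "a = 0") auto
  define M where "M h = L h / a" for h
  have "mean_on_Cb_ru M"
    unfolding mean_on_Cb_ru_def positive_linear_on_def
    using a L by (auto simp: M_def subspace_Cb_ru add_divide_distrib plin_add[OF L] plin_scale[OF L] a_def plin_nonneg[OF L])
  moreover have "L (ltrans g h) = 1 - (norm h + 1) * a" for g
  proof -
    have "ltrans g h = ltrans g k - (norm h + 1) *\<^sub>R ?one" by (simp add: k_def ltrans_add ltrans_scaleR)
    then show ?thesis
      by (simp add: plin_diff[OF L] ltrans_Cb_ru kC one_Cb_ru subspace_scale[OF subspace_Cb_ru] Lk plin_scale[OF L] a_def)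
  qed
  then have "M (ltrans g h) = M h" for g unfolding M_def by (metis ltrans_zero)
  ultimately show thesis by (rule that)
qed

text \<open>Composing with the orbit map of a mean turns the functions on which it is already invariant
  into constants, so invariance on one further function can be gained without losing the others.\<close>

lemma mean_invariant_on_finite:
  fixes H :: "('a::topological_group_add \<Rightarrow>\<^sub>C real) set"
  assumes tp: "translate_property (Cb_ru :: ('a \<Rightarrow>\<^sub>C real) set)"
    and "finite H" "H \<subseteq> Cb_ru"
  shows "\<exists>M. mean_on_Cb_ru M \<and> (\<forall>h\<in>H. \<forall>g. M (ltrans g h) = M h)"
  using assms(2,3)
proof (induction H rule: finite_induct)
  case empty
  obtain M :: "('a \<Rightarrow>\<^sub>C real) \<Rightarrow> real" where "mean_on_Cb_ru M"
    by (rule mean_invariant_on_one[OF tp one_Cb_ru])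
  then show ?case by auto
next
  case (insert h H)
  then obtain M where M: "mean_on_Cb_ru M" and inv: "\<And>k g. k \<in> H \<Longrightarrow> M (ltrans g k) = M k" by auto
  have pM: "positive_linear_on (dominated_by_translates Cb_ru one_bcontfun) M"
    and M1: "\<And>g. M (ltrans g one_bcontfun) = 1"
    using M by (auto simp: mean_on_Cb_ru_def dominated_eq_Cb_ru one_Cb_ru)
  have one_nonneg: "\<And>x :: 'a. 0 \<le> apply_bcontfun one_bcontfun x" by simp
  note orbit = orbit_map_Cb_ru[OF one_Cb_ru one_nonneg pM M1, unfolded uniformly_dominated_one]
    apply_orbit_map[OF one_Cb_ru one_nonneg pM M1, unfolded uniformly_dominated_one]
    orbit_map_ltrans[OF one_Cb_ru one_nonneg pM M1, unfolded uniformly_dominated_one]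
    positive_linear_on_orbit_map[OF one_Cb_ru one_nonneg pM M1, unfolded uniformly_dominated_one]
  have h: "h \<in> Cb_ru" using insert.prems by simp
  obtain N where N: "mean_on_Cb_ru N" "\<And>g. N (ltrans g (orbit_map M h)) = N (orbit_map M h)"
    using mean_invariant_on_one[OF tp orbit(1)[OF h]] by blast
  have pN: "positive_linear_on Cb_ru N" and N1: "N one_bcontfun = 1"
    using N(1) by (auto simp: mean_on_Cb_ru_def)
  have const: "N (orbit_map M k) = c" if "k \<in> Cb_ru" "\<And>g. M (ltrans g k) = c" for k c
  proof -
    have "orbit_map M k = c *\<^sub>R one_bcontfun"
      by (rule bcontfun_eqI) (simp add: orbit(2) that)
    then show ?thesis by (simp add: plin_scale[OF pN one_Cb_ru] N1)
  qed
  show ?case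
  proof (intro exI[of _ "\<lambda>k. N (orbit_map M k)"] conjI ballI allI)
    show "mean_on_Cb_ru (\<lambda>k. N (orbit_map M k))"
      using orbit(4)[OF pN] const[OF one_Cb_ru M1] by (simp add: mean_on_Cb_ru_def)
    fix k g assume k: "k \<in> insert h H"
    show "N (orbit_map M (ltrans g k)) = N (orbit_map M k)"
    proof (cases "k = h")
      case True
      then show ?thesis using N(2) orbit(3)[OF h] by simp
    next
      case False
      then have kH: "k \<in> H" "k \<in> Cb_ru" using k insert.prems by auto
      then have "N (orbit_map M (ltrans g k)) = M k" "N (orbit_map M k) = M k"
        by (auto intro!: const ltrans_Cb_ru simp: inv ltrans_ltrans)
      then show ?thesis by simp
    qed
  qed
qed

text \<open>The extension theorem does the work of a compactness argument: the value 1 is prescribed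
  at the constant 1 and the value 0 at all \<open>ltrans g h - h\<close>. Each element of the span
  involves only finitely many \<open>h\<close>, so a mean invariant on these shows that the
  prescription is positive.\<close>

lemma invariant_mean:
  assumes tp: "translate_property (Cb_ru :: ('a::topological_group_add \<Rightarrow>\<^sub>C real) set)"
  obtains M :: "('a::topological_group_add \<Rightarrow>\<^sub>C real) \<Rightarrow> real"
  where "mean_on_Cb_ru M" "\<And>g h. h \<in> Cb_ru \<Longrightarrow> M (ltrans g h) = M h"
proof -
  let ?V = "Cb_ru :: ('a \<Rightarrow>\<^sub>C real) set"
  let ?S = "insert (one_bcontfun, 1) {(ltrans g h - h, 0 :: real) | g h. h \<in> ?V}"
  \<comment> \<open>A finite certificate for a pair in the span: every mean invariant on
    \<open>H\<close> respects the pair.\<close>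
  define determines where "determines H p \<longleftrightarrow> finite H \<and> H \<subseteq> ?V \<and>
      (\<forall>M. mean_on_Cb_ru M \<longrightarrow> (\<forall>h\<in>H. \<forall>g. M (ltrans g h) = M h) \<longrightarrow> M (fst p) = snd p)" for H p
  have rep: "fst p \<in> ?V \<and> (\<exists>H. determines H p)" if "p \<in> span ?S" for p
    using that
  proof (induction rule: span_induct_alt)
    case base
    have "M (0 :: 'a \<Rightarrow>\<^sub>C real) = 0" if "mean_on_Cb_ru M" for M
      using that plin_zero unfolding mean_on_Cb_ru_def by blast
    then have "determines {} 0" by (simp add: determines_def)
    then show ?case using subspace_0[OF subspace_Cb_ru] by auto
  next
    case (step c x y)
    obtain H where y: "fst y \<in> ?V" and H: "determines H y" using step.IH by auto
    have "fst x \<in> ?V \<and> (\<exists>K. determines K x)"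
    proof -
      consider "x = (one_bcontfun, 1)" | g h where "x = (ltrans g h - h, 0)" "h \<in> ?V"
        using step.hyps by auto
      then show ?thesis
      proof cases
        case 1
        then have "determines {} x" by (simp add: determines_def mean_on_Cb_ru_def)
        then show ?thesis using 1 one_Cb_ru by auto
      next
        case 2
        have "M (ltrans g h - h) = 0" if "mean_on_Cb_ru M" "M (ltrans g h) = M h" for M
          using that plin_diff[of ?V M "ltrans g h" h] 2(2) ltrans_Cb_ru[of h g] by (auto simp: mean_on_Cb_ru_def)
        then have "determines {h} x" using 2 by (simp add: determines_def)
        then show ?thesis using 2 by (auto intro!: subspace_diff[OF subspace_Cb_ru] ltrans_Cb_ru)
      qed
    qed
    then obtain K where x: "fst x \<in> ?V" and K: "determines K x" by auto
    have cx: "c *\<^sub>R fst x \<in> ?V" using x by (rule subspace_scale[OF subspace_Cb_ru])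
    have "determines (H \<union> K) (c *\<^sub>R x + y)"
      unfolding determines_def
    proof (intro conjI allI impI)
      show "finite (H \<union> K)" "H \<union> K \<subseteq> ?V" using H K by (auto simp: determines_def)
      fix M :: "('a \<Rightarrow>\<^sub>C real) \<Rightarrow> real"
      assume M: "mean_on_Cb_ru M" "\<forall>h\<in>H \<union> K. \<forall>g. M (ltrans g h) = M h"
      then have "M (fst x) = snd x" "M (fst y) = snd y" using H K by (auto simp: determines_def)
      moreover have pM: "positive_linear_on ?V M" using M(1) by (simp add: mean_on_Cb_ru_def)
      ultimately show "M (fst (c *\<^sub>R x + y)) = snd (c *\<^sub>R x + y)"
        by (simp add: plin_add[OF pM cx y] plin_scale[OF pM x])
    qed
    moreover have "fst (c *\<^sub>R x + y) \<in> ?V" using subspace_add[OF subspace_Cb_ru cx y] by simp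
    ultimately show ?case by blast
  qed
  have one: "(one_bcontfun, 1) \<in> span ?S" by (intro span_base) simp
  have "span ?S \<subseteq> ?V \<times> UNIV" using rep by (auto simp: mem_Times_iff)
  moreover have "0 \<le> t" if wt: "(w, t) \<in> span ?S" "\<And>x. 0 \<le> apply_bcontfun w x" for w t
  proof -
    obtain H where w: "w \<in> ?V" and H: "determines H (w, t)" using rep[OF wt(1)] by auto
    then have "finite H" "H \<subseteq> ?V" by (simp_all add: determines_def)
    from mean_invariant_on_finite[OF tp this]
    obtain M where M: "mean_on_Cb_ru M" "\<forall>h\<in>H. \<forall>g. M (ltrans g h) = M h" by auto
    then have "M w = t" using H by (simp add: determines_def)
    moreover have "positive_linear_on ?V M" using M(1) by (simp add: mean_on_Cb_ru_def)
    then have "0 \<le> M w" using w wt(2) by (rule plin_nonneg)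
    ultimately show ?thesis by simp
  qed
  moreover have "\<exists>w t. (w, t) \<in> span ?S \<and> (\<forall>x. apply_bcontfun v x \<le> apply_bcontfun w x)" for v :: "'a \<Rightarrow>\<^sub>C real"
  proof (intro exI conjI allI)
    show "(norm v *\<^sub>R one_bcontfun, norm v * 1) \<in> span ?S"
      using span_scale[OF one, of "norm v"] by simp
    show "apply_bcontfun v x \<le> apply_bcontfun (norm v *\<^sub>R one_bcontfun) x" for x
      using norm_bounded[of v x] by simp
  qed
  ultimately obtain M where M: "positive_linear_on ?V M" "\<And>w t. (w, t) \<in> span ?S \<Longrightarrow> M w = t"
    by (rule positive_extension_bcontfun[OF subspace_Cb_ru subspace_span]) blast+
  have "mean_on_Cb_ru M" using M(1) M(2)[OF one] by (simp add: mean_on_Cb_ru_def)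
  moreover have "M (ltrans g h) = M h" if "h \<in> ?V" for g h
  proof -
    have "M (ltrans g h - h) = 0" using that by (intro M(2) span_base) blast
    then show ?thesis using plin_diff[OF M(1) ltrans_Cb_ru[OF that] that] by simp
  qed
  ultimately show thesis by (rule that)
qed

section \<open>Invariant integrals on uniformly dominated functions\<close>

text \<open>An invariant mean is composed with the orbit map of a functional that is 1 on all
  translates of \<open>f\<close>. The orbit map commutes with translations, which gives invariance,
  and sends \<open>f\<close> to the constant 1, which gives the normalization.\<close>

lemma invariant_integral_uniformly_dominated:
  fixes f :: "'a::topological_group_add \<Rightarrow>\<^sub>C real"
  assumes tp: "translate_property (Cb_ru :: ('a \<Rightarrow>\<^sub>C real) set)"
    and f: "f \<in> uniformly_dominated f" "f \<noteq> 0" and nonneg: "\<And>x. 0 \<le> apply_bcontfun f x"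
  obtains I where "positive_linear_on (uniformly_dominated f) I"
    "\<And>h g. h \<in> uniformly_dominated f \<Longrightarrow> I (ltrans g h) = I h" "I f = 1"
proof -
  have fC: "f \<in> Cb_ru" using f(1) by (simp add: uniformly_dominated_def dominated_by_translates_def)
  obtain L where L: "positive_linear_on (dominated_by_translates Cb_ru f) L" "\<And>g. L (ltrans g f) = 1"
    using translate_functional[OF tp fC f(2) nonneg] by blast
  obtain M :: "('a \<Rightarrow>\<^sub>C real) \<Rightarrow> real"
    where M: "mean_on_Cb_ru M" "\<And>g h. h \<in> Cb_ru \<Longrightarrow> M (ltrans g h) = M h"
    using invariant_mean[OF tp] by blast
  show thesis
  proof (rule that[of "\<lambda>h. M (orbit_map L h)"])
    show "positive_linear_on (uniformly_dominated f) (\<lambda>h. M (orbit_map L h))"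
      using M(1) by (intro positive_linear_on_orbit_map[OF fC nonneg L]) (simp add: mean_on_Cb_ru_def)
    show "M (orbit_map L (ltrans g h)) = M (orbit_map L h)" if "h \<in> uniformly_dominated f" for g h
      using orbit_map_ltrans[OF fC nonneg L that] M(2) orbit_map_Cb_ru[OF fC nonneg L that] by simp
    have "orbit_map L f = one_bcontfun"
      by (rule bcontfun_eqI) (simp add: apply_orbit_map[OF fC nonneg L f(1)] L(2))
    then show "M (orbit_map L f) = 1" using M(1) by (simp add: mean_on_Cb_ru_def)
  qed
qed

subsection \<open>Compactly supported functions\<close>

definition Cc :: "('a::topological_space \<Rightarrow>\<^sub>C real) set"
  where "Cc = {h. \<exists>K. compact K \<and> (\<forall>x. x \<notin> K \<longrightarrow> apply_bcontfun h x = 0)}"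

lemma CcI: "compact K \<Longrightarrow> (\<And>x. x \<notin> K \<Longrightarrow> apply_bcontfun h x = 0) \<Longrightarrow> h \<in> Cc"
  unfolding Cc_def by blast

lemma CcE:
  assumes "h \<in> Cc"
  obtains K where "compact K" "\<And>x. x \<notin> K \<Longrightarrow> apply_bcontfun h x = 0"
  using assms unfolding Cc_def by blast

lemma subspace_Cc: "subspace Cc"
proof (rule subspaceI)
  show "0 \<in> Cc" by (rule CcI[of "{}"]) auto
  show "h + k \<in> Cc" if "h \<in> Cc" "k \<in> Cc" for h k :: "'a \<Rightarrow>\<^sub>C real"
  proof -
    obtain K where K: "compact K" "\<And>x. x \<notin> K \<Longrightarrow> apply_bcontfun h x = 0" using \<open>h \<in> Cc\<close> by (rule CcE) blast
    obtain L where L: "compact L" "\<And>x. x \<notin> L \<Longrightarrow> apply_bcontfun k x = 0" using \<open>k \<in> Cc\<close> by (rule CcE) blast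
    show ?thesis using K L by (intro CcI[of "K \<union> L"]) auto
  qed
  show "c *\<^sub>R h \<in> Cc" if "h \<in> Cc" for c and h :: "'a \<Rightarrow>\<^sub>C real"
    using that by (auto elim!: CcE intro!: CcI)
qed

lemma ltrans_Cc:
  fixes h :: "'a::topological_group_add \<Rightarrow>\<^sub>C real"
  assumes "h \<in> Cc" shows "ltrans g h \<in> Cc"
proof -
  obtain K where K: "compact K" "\<And>x. x \<notin> K \<Longrightarrow> apply_bcontfun h x = 0" using assms by (rule CcE) blast
  have "compact ((\<lambda>x. g + x) ` K)"
    using K(1) by (intro compact_continuous_image continuous_intros)
  then show ?thesis
  proof (rule CcI)
    fix x assume "x \<notin> (\<lambda>x. g + x) ` K"
    then have "- g + x \<notin> K" by (metis add_minus_cancel imageI)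
    then show "apply_bcontfun (ltrans g h) x = 0" using K(2) by simp
  qed
qed

lift_definition rtrans :: "'a::topological_group_add \<Rightarrow> ('a \<Rightarrow>\<^sub>C real) \<Rightarrow> ('a \<Rightarrow>\<^sub>C real)"
  is "\<lambda>g f x. f (x + g)"
proof -
  fix g :: 'a and f :: "'a \<Rightarrow> real"
  assume f: "f \<in> bcontfun"
  have "continuous_on UNIV (f \<circ> (\<lambda>x. x + g))"
    using f by (intro continuous_on_compose continuous_intros)
      (auto simp: bcontfun_def intro: continuous_on_subset)
  moreover have "bounded (range (\<lambda>x. f (x + g)))"
    using f by (auto simp: bcontfun_def intro: bounded_subset)
  ultimately show "(\<lambda>x. f (x + g)) \<in> bcontfun"
    by (simp add: bcontfun_def o_def)
qed

lemma apply_rtrans [simp]: "apply_bcontfun (rtrans g f) x = apply_bcontfun f (x + g)"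
  by (simp add: rtrans.rep_eq)

lemma rtrans_Cc:
  fixes h :: "'a::topological_group_add \<Rightarrow>\<^sub>C real"
  assumes "h \<in> Cc" shows "rtrans g h \<in> Cc"
proof -
  obtain K where K: "compact K" "\<And>x. x \<notin> K \<Longrightarrow> apply_bcontfun h x = 0" using assms by (rule CcE) blast
  have "compact ((\<lambda>x. x - g) ` K)"
    using K(1) by (intro compact_continuous_image continuous_intros)
  then show ?thesis
  proof (rule CcI)
    fix x assume "x \<notin> (\<lambda>x. x - g) ` K"
    then have "x + g \<notin> K" by (metis add_diff_cancel imageI)
    then show "apply_bcontfun (rtrans g h) x = 0" using K(2) by simp
  qed
qed

text \<open>The second factor is a plain function, since its continuity suffices: the compact
  support of the first factor makes the product bounded.\<close>

definition Cc_mult :: "('a::topological_space \<Rightarrow>\<^sub>C real) \<Rightarrow> ('a \<Rightarrow> real) \<Rightarrow> ('a \<Rightarrow>\<^sub>C real)"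
  where "Cc_mult h G = Bcontfun (\<lambda>x. apply_bcontfun h x * G x)"

lemma
  fixes h :: "'a::t2_space \<Rightarrow>\<^sub>C real"
  assumes "h \<in> Cc" and G: "continuous_on UNIV G"
  shows apply_Cc_mult: "apply_bcontfun (Cc_mult h G) x = apply_bcontfun h x * G x"
    and Cc_mult_Cc: "Cc_mult h G \<in> Cc"
proof -
  obtain K where K: "compact K" "\<And>x. x \<notin> K \<Longrightarrow> apply_bcontfun h x = 0" using assms(1) by (rule CcE) blast
  let ?F = "\<lambda>x. apply_bcontfun h x * G x"
  have cont: "continuous_on UNIV ?F" by (intro continuous_intros G continuous_on_apply_bcontfun)
  have "bounded (?F ` K)"
    using K(1) by (intro compact_imp_bounded compact_continuous_image continuous_on_subset[OF cont]) auto
  then have "bounded (insert 0 (?F ` K))" by simp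
  moreover have "range ?F \<subseteq> insert 0 (?F ` K)"
  proof
    fix y assume "y \<in> range ?F"
    then obtain x where x: "y = ?F x" by blast
    show "y \<in> insert 0 (?F ` K)"
      by (cases "x \<in> K") (simp_all add: x K(2))
  qed
  ultimately have "bounded (range ?F)" by (rule bounded_subset)
  with cont have "?F \<in> bcontfun" by (simp add: bcontfun_def)
  then have *: "apply_bcontfun (Cc_mult h G) x = ?F x" for x
    by (simp add: Cc_mult_def Bcontfun_inverse)
  then show "apply_bcontfun (Cc_mult h G) x = ?F x" .
  show "Cc_mult h G \<in> Cc" using K by (intro CcI[of K]) (simp_all add: *)
qed

lemma Cc_mult_const:
  fixes h :: "'a::t2_space \<Rightarrow>\<^sub>C real"
  assumes "h \<in> Cc" shows "Cc_mult h (\<lambda>_. c) = c *\<^sub>R h"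
  by (rule bcontfun_eqI) (simp add: apply_Cc_mult assms)

text \<open>Translation by \<open>y - a\<close> moves a point \<open>a\<close> where
  \<open>k\<close> is positive to \<open>y\<close>. By compactness finitely many such translates
  suffice: at each point of \<open>K\<close> one of them exceeds half the value at \<open>a\<close>,
  and the others are nonnegative.\<close>

lemma translates_lower_bound:
  fixes k :: "'a::topological_group_add \<Rightarrow>\<^sub>C real"
  assumes nonneg: "\<And>x. 0 \<le> apply_bcontfun k x" and "k \<noteq> 0" and "compact K"
  obtains D c where "finite D" "0 < c" "\<And>x. x \<in> K \<Longrightarrow> c \<le> (\<Sum>d\<in>D. apply_bcontfun k (- d + x))"
proof -
  have "\<exists>a. apply_bcontfun k a \<noteq> 0" using \<open>k \<noteq> 0\<close> by (metis bcontfun_eqI zero_bcontfun.rep_eq)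
  then obtain a where a: "0 < apply_bcontfun k a" using nonneg by (metis order_le_less)
  define c where "c = apply_bcontfun k a / 2"
  have c: "0 < c" "c < apply_bcontfun k a" using a by (simp_all add: c_def)
  define W where "W y = {z. c < apply_bcontfun k (- (y - a) + z)}" for y
  have "open (W y)" for y
    unfolding W_def
    by (intro open_Collect_less continuous_intros continuous_on_compose2[OF continuous_on_apply_bcontfun[of UNIV]]) auto
  moreover have "y \<in> W y" for y using c by (simp add: W_def)
  then have "K \<subseteq> (\<Union>y\<in>K. W y)" by blast
  ultimately obtain E where E: "E \<subseteq> K" "finite E" "K \<subseteq> (\<Union>y\<in>E. W y)"
    by (rule compactE_image[OF \<open>compact K\<close>]) blast
  show thesis
  proof (rule that[of "(\<lambda>y. y - a) ` E" c])
    fix x assume "x \<in> K"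
    then obtain y where y: "y \<in> E" "x \<in> W y" using E by blast
    have "c \<le> apply_bcontfun k (- (y - a) + x)" using y(2) by (simp add: W_def)
    also have "\<dots> \<le> (\<Sum>d\<in>(\<lambda>y. y - a) ` E. apply_bcontfun k (- d + x))"
      using y(1) E(2) nonneg by (intro member_le_sum) auto
    finally show "c \<le> (\<Sum>d\<in>(\<lambda>y. y - a) ` E. apply_bcontfun k (- d + x))" .
  qed (use E c in auto)
qed

lemma dominated_oscillation_Cb_ru:
  assumes "dominated_oscillation h P" shows "h \<in> Cb_ru"
proof -
  have "\<forall>\<^sub>F u in nhds 0. \<forall>x. \<bar>apply_bcontfun h (- u + x) - apply_bcontfun h x\<bar> \<le> e" if e: "0 < e" for e
  proof -
    have pos: "0 < norm P + 1" using norm_ge_zero[of P] by linarith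
    then have "\<forall>\<^sub>F u in nhds 0. \<forall>x. \<bar>apply_bcontfun h (- u + x) - apply_bcontfun h x\<bar> \<le> e / (norm P + 1) * apply_bcontfun P x"
      using assms[unfolded dominated_oscillation_def, rule_format, of "e / (norm P + 1)"] e by simp
    then show ?thesis
    proof eventually_elim
      case (elim u)
      show ?case
      proof
        fix x
        have "\<bar>apply_bcontfun h (- u + x) - apply_bcontfun h x\<bar> \<le> e / (norm P + 1) * apply_bcontfun P x"
          using elim by blast
        also have "\<dots> \<le> e / (norm P + 1) * (norm P + 1)"
          using norm_bounded[of P x] e pos by (intro mult_left_mono) auto
        finally show "\<bar>apply_bcontfun h (- u + x) - apply_bcontfun h x\<bar> \<le> e" using pos by simp
      qed
    qed
  qed
  then obtain k where k: "k \<in> Cb_ru" "\<And>x. apply_bcontfun k x = apply_bcontfun h x"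
    using Cb_ru_obtain[of "apply_bcontfun h" "norm h"] norm_bounded[of h] by auto
  from k(2) have "k = h" by (rule bcontfun_eqI)
  with k(1) show ?thesis by simp
qed

section \<open>Bumps, oscillation and partitions on a locally compact group\<close>

context
  assumes lc: "locally_compact_space (euclidean :: 'a::{topological_group_add, t2_space} topology)"
begin

lemma compact_neighbourhood: "\<exists>W K. open W \<and> compact K \<and> (a::'a) \<in> W \<and> W \<subseteq> K"
  using lc unfolding locally_compact_space_def by (simp add: compactin_euclidean_iff flip: open_openin)

text \<open>Urysohn's construction: a locally compact Hausdorff space is completely regular, and
  cutting \<open>U\<close> down to a relatively compact neighbourhood makes the support
  compact.\<close>

lemma Cc_bump:
  fixes U :: "'a set"
  assumes "open U" "a \<in> U"
  obtains b where "b \<in> Cc" "\<And>x. 0 \<le> apply_bcontfun b x" "apply_bcontfun b a = 1"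
    "\<And>x. x \<notin> U \<Longrightarrow> apply_bcontfun b x = 0"
proof -
  obtain W K where W: "open W" "compact K" "a \<in> W" "W \<subseteq> K"
    using compact_neighbourhood by blast
  have "completely_regular_space (euclidean :: 'a topology)"
    using lc
  proof (rule locally_compact_regular_imp_completely_regular_space)
    have "Hausdorff_space (euclidean :: 'a topology)"
      unfolding Hausdorff_space_def disjnt_def using hausdorff by auto
    then show "Hausdorff_space (euclidean :: 'a topology) \<or> regular_space (euclidean :: 'a topology)" ..
  qed
  moreover have "openin euclidean (U \<inter> W)" "a \<in> U \<inter> W" using assms W by auto
  ultimately have "\<exists>f. continuous_map euclidean euclideanreal f \<and> f a = 0 \<and>
      f ` (topspace euclidean - U \<inter> W) \<subseteq> {1}"
    unfolding completely_regular_space_alt' by blast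
  then obtain f where f: "continuous_map euclidean euclideanreal f" "f a = (0::real)"
    "f ` (UNIV - U \<inter> W) \<subseteq> {1}"
    by auto
  \<comment> \<open>The separating function need not have values in the unit interval, hence the
    truncation on both sides.\<close>
  let ?b = "\<lambda>x. max 0 (min 1 (1 - f x))"
  have "continuous_on UNIV f" using f(1) by simp
  then have "?b \<in> bcontfun" by (intro bcontfun_normI[of _ 1] continuous_intros) auto
  then obtain b where b: "?b = apply_bcontfun b" by (rule bcontfunE)
  have b': "apply_bcontfun b x = ?b x" for x using b by metis
  have out: "apply_bcontfun b x = 0" if "x \<notin> U \<inter> W" for x
  proof -
    have "f x = 1" using f(3) that by blast
    then show ?thesis by (simp add: b')
  qed
  show thesis
  proof (rule that[of b])
    show "b \<in> Cc" using W out by (intro CcI[of K]) auto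
  qed (use f(2) out in \<open>auto simp: b'\<close>)
qed

lemma Cc_bump_zero:
  obtains b :: "'a \<Rightarrow>\<^sub>C real" where "b \<in> Cc" "\<And>x. 0 \<le> apply_bcontfun b x" "apply_bcontfun b 0 = 1" "b \<noteq> 0"
proof -
  obtain b :: "'a \<Rightarrow>\<^sub>C real" where b: "b \<in> Cc" "\<And>x. 0 \<le> apply_bcontfun b x" "apply_bcontfun b 0 = 1"
    by (rule Cc_bump[of UNIV 0]) auto
  then have "b \<noteq> 0" by auto
  with b show thesis by (rule that)
qed

lemma Cc_above_one:
  fixes K :: "'a set"
  assumes "compact K"
  obtains p where "p \<in> Cc" "\<And>x. 0 \<le> apply_bcontfun p x" "\<And>x. x \<in> K \<Longrightarrow> 1 \<le> apply_bcontfun p x"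
proof -
  obtain b :: "'a \<Rightarrow>\<^sub>C real" where b: "b \<in> Cc" "\<And>x. 0 \<le> apply_bcontfun b x" "apply_bcontfun b 0 = 1" "b \<noteq> 0"
    by (rule Cc_bump_zero) blast
  obtain D c where D: "finite D" "0 < c" "\<And>x. x \<in> K \<Longrightarrow> c \<le> (\<Sum>d\<in>D. apply_bcontfun b (- d + x))"
    using translates_lower_bound[OF b(2,4) assms] by blast
  show thesis
  proof (rule that[of "(1 / c) *\<^sub>R (\<Sum>d\<in>D. ltrans d b)"])
    show "(1 / c) *\<^sub>R (\<Sum>d\<in>D. ltrans d b) \<in> Cc"
      by (intro subspace_scale[OF subspace_Cc] subspace_sum[OF subspace_Cc] ltrans_Cc b)
    show "0 \<le> apply_bcontfun ((1 / c) *\<^sub>R (\<Sum>d\<in>D. ltrans d b)) x" for x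
      using D(2) b(2) by (simp add: sum_apply sum_nonneg)
    show "1 \<le> apply_bcontfun ((1 / c) *\<^sub>R (\<Sum>d\<in>D. ltrans d b)) x" if "x \<in> K" for x
      using D(2) D(3)[OF that] by (simp add: sum_apply field_simps)
  qed
qed

lemma Cc_majorant:
  fixes h :: "'a \<Rightarrow>\<^sub>C real"
  assumes "h \<in> Cc"
  obtains q where "q \<in> Cc" "\<And>x. \<bar>apply_bcontfun h x\<bar> \<le> apply_bcontfun q x"
proof -
  obtain K where K: "compact K" "\<And>x. x \<notin> K \<Longrightarrow> apply_bcontfun h x = 0" using assms by (rule CcE) blast
  obtain p where p: "p \<in> Cc" "\<And>x. 0 \<le> apply_bcontfun p x" "\<And>x. x \<in> K \<Longrightarrow> 1 \<le> apply_bcontfun p x"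
    using Cc_above_one[OF K(1)] by blast
  show thesis
  proof (rule that[of "norm h *\<^sub>R p"])
    show "norm h *\<^sub>R p \<in> Cc" by (intro subspace_scale[OF subspace_Cc] p)
    show "\<bar>apply_bcontfun h x\<bar> \<le> apply_bcontfun (norm h *\<^sub>R p) x" for x
    proof (cases "x \<in> K")
      case True
      then show ?thesis using mult_left_mono[OF p(3)[OF True], of "norm h"] norm_bounded[of h x] by simp
    qed (simp add: K p)
  qed
qed

text \<open>This treats left and right translations together: \<open>\<theta> (u, x)\<close> is the
  point \<open>x\<close> moved by \<open>u\<close>, and \<open>\<kappa> (u, _)\<close> undoes the
  move. For \<open>u\<close> in a compact neighbourhood of 0, everything happens on one compact set
  \<open>L\<close>, where \<open>h\<close> composed with \<open>\<theta>\<close> is uniformly close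
  to \<open>h\<close>; a function in \<open>Cc\<close> that is at least 1 on \<open>L\<close> serves
  as weight.\<close>

lemma Cc_oscillation_general:
  fixes h :: "'a \<Rightarrow>\<^sub>C real" and \<theta> :: "'a \<times> 'a \<Rightarrow> 'a" and \<kappa> :: "'a \<times> 'a \<Rightarrow> 'a"
  assumes h: "h \<in> Cc"
    and cont: "continuous_on UNIV \<theta>" "continuous_on UNIV \<kappa>"
    and \<theta>: "\<And>x. \<theta> (0, x) = x" "\<And>u x. \<kappa> (u, \<theta> (u, x)) = x"
  obtains p where "p \<in> Cc" "\<And>x. 0 \<le> apply_bcontfun p x"
    "\<And>e. 0 < e \<Longrightarrow> \<forall>\<^sub>F u in nhds 0. \<forall>x. \<bar>apply_bcontfun h (\<theta> (u, x)) - apply_bcontfun h x\<bar> \<le> e * apply_bcontfun p x"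
proof -
  obtain K where K: "compact K" "\<And>x. x \<notin> K \<Longrightarrow> apply_bcontfun h x = 0" using h by (rule CcE) blast
  obtain W N where W: "open W" "compact N" "(0::'a) \<in> W" "W \<subseteq> N"
    using compact_neighbourhood by blast
  define L where "L = \<kappa> ` (N \<times> K)"
  have L: "compact L"
    unfolding L_def using W K by (intro compact_continuous_image compact_Times continuous_on_subset[OF cont(2)]) auto
  have out: "apply_bcontfun h (\<theta> (u, x)) = 0" if "u \<in> N" "x \<notin> L" for u x
  proof (rule K(2))
    show "\<theta> (u, x) \<notin> K" using that \<theta>(2)[of u x] unfolding L_def by (metis SigmaI imageI)
  qed
  obtain p where p: "p \<in> Cc" "\<And>x. 0 \<le> apply_bcontfun p x" "\<And>x. x \<in> L \<Longrightarrow> 1 \<le> apply_bcontfun p x"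
    using Cc_above_one[OF L] by blast
  show thesis
  proof (rule that[OF p(1,2)])
    fix e :: real assume e: "0 < e"
    have "continuous_on (UNIV \<times> L) (\<lambda>z. apply_bcontfun h (\<theta> z))"
      by (intro continuous_on_compose2[OF continuous_on_apply_bcontfun[of UNIV]] continuous_on_subset[OF cont(1)]) auto
    \<comment> \<open>Compactness of \<open>L\<close> makes the neighbourhood of
      \<open>u = 0\<close> independent of \<open>x\<close>.\<close>
    from continuous_on_prod_compactE[OF this L UNIV_I e, of 0]
    obtain X where X: "0 \<in> X" "open X"
      "\<forall>u\<in>X \<inter> UNIV. \<forall>x\<in>L. dist (apply_bcontfun h (\<theta> (u, x))) (apply_bcontfun h (\<theta> (0, x))) \<le> e" by blast
    have "\<bar>apply_bcontfun h (\<theta> (u, x)) - apply_bcontfun h x\<bar> \<le> e * apply_bcontfun p x"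
      if u: "u \<in> X \<inter> W" for u x
    proof (cases "x \<in> L")
      case True
      then have "\<bar>apply_bcontfun h (\<theta> (u, x)) - apply_bcontfun h x\<bar> \<le> e"
        using X(3) u by (auto simp: \<theta>(1) dist_real_def)
      also have "\<dots> \<le> e * apply_bcontfun p x" using p(3)[OF True] e by simp
      finally show ?thesis .
    next
      case False
      \<comment> \<open>Since 0 is also in \<open>N\<close>, the function \<open>h\<close> itself
        vanishes outside \<open>L\<close>.\<close>
      then have "apply_bcontfun h (\<theta> (u, x)) = 0" "apply_bcontfun h (\<theta> (0, x)) = 0"
        using u W by (auto intro!: out)
      then show ?thesis using p(2)[of x] e by (simp add: \<theta>(1))
    qed
    then show "\<forall>\<^sub>F u in nhds 0. \<forall>x. \<bar>apply_bcontfun h (\<theta> (u, x)) - apply_bcontfun h x\<bar> \<le> e * apply_bcontfun p x"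
      unfolding eventually_nhds using X W by (intro exI[of _ "X \<inter> W"]) auto
  qed
qed

lemma Cc_left_oscillation:
  fixes h :: "'a \<Rightarrow>\<^sub>C real"
  assumes "h \<in> Cc"
  obtains p where "p \<in> Cc" "dominated_oscillation h p"
proof -
  have "continuous_on UNIV (\<lambda>z::'a \<times> 'a. - fst z + snd z)" "continuous_on UNIV (\<lambda>z::'a \<times> 'a. fst z + snd z)"
    by (intro continuous_intros)+
  then obtain p where p: "p \<in> Cc"
    "\<And>e. 0 < e \<Longrightarrow> \<forall>\<^sub>F u in nhds 0. \<forall>x.
      \<bar>apply_bcontfun h (- fst (u, x) + snd (u, x)) - apply_bcontfun h x\<bar> \<le> e * apply_bcontfun p x"
    by (rule Cc_oscillation_general[OF assms]) (auto simp del: add_uminus_conv_diff)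
  show thesis
    by (rule that[OF p(1)]) (use p(2) in \<open>simp add: dominated_oscillation_def\<close>)
qed

lemma Cc_right_oscillation:
  fixes h :: "'a \<Rightarrow>\<^sub>C real"
  assumes "h \<in> Cc"
  obtains p where "p \<in> Cc"
    "\<And>e. 0 < e \<Longrightarrow> \<forall>\<^sub>F u in nhds 0. \<forall>x. \<bar>apply_bcontfun h (x + u) - apply_bcontfun h x\<bar> \<le> e * apply_bcontfun p x"
proof -
  have "continuous_on UNIV (\<lambda>z::'a \<times> 'a. snd z + fst z)" "continuous_on UNIV (\<lambda>z::'a \<times> 'a. snd z - fst z)"
    by (intro continuous_intros)+
  then obtain p where p: "p \<in> Cc"
    "\<And>e. 0 < e \<Longrightarrow> \<forall>\<^sub>F u in nhds 0. \<forall>x.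
      \<bar>apply_bcontfun h (snd (u, x) + fst (u, x)) - apply_bcontfun h x\<bar> \<le> e * apply_bcontfun p x"
    by (rule Cc_oscillation_general[OF assms]) auto
  show thesis
    by (rule that[OF p(1)]) (use p(2) in simp)
qed

lemma Cc_subset_Cb_ru: "(Cc :: ('a \<Rightarrow>\<^sub>C real) set) \<subseteq> Cb_ru"
  using Cc_left_oscillation dominated_oscillation_Cb_ru by blast

text \<open>On the compact set carrying \<open>h\<close>, a finite sum of translates of
  \<open>k\<close> is bounded below by a positive constant, so a multiple of it majorizes
  \<open>h\<close>.\<close>

lemma Cc_dominated:
  fixes h k :: "'a \<Rightarrow>\<^sub>C real"
  assumes h: "h \<in> Cc" and k: "k \<in> Cb_ru" "k \<noteq> 0" and nonneg: "\<And>x. 0 \<le> apply_bcontfun k x"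
  shows "h \<in> dominated_by_translates Cb_ru k"
proof -
  obtain K where K: "compact K" "\<And>x. x \<notin> K \<Longrightarrow> apply_bcontfun h x = 0" using h by (rule CcE) blast
  obtain D c where D: "finite D" "0 < c" "\<And>x. x \<in> K \<Longrightarrow> c \<le> (\<Sum>d\<in>D. apply_bcontfun k (- d + x))"
    using translates_lower_bound[OF nonneg k(2) K(1)] by blast
  show ?thesis
  proof (rule dominated_mono)
    show "h \<in> Cb_ru" using h Cc_subset_Cb_ru by blast
    show "(norm h / c) *\<^sub>R (\<Sum>d\<in>D. ltrans d k) \<in> dominated_by_translates Cb_ru k"
      using k(1) nonneg by (intro subspace_scale[OF subspace_dominated] subspace_sum[OF subspace_dominated] ltrans_dominated self_dominated)
    fix x
    show "\<bar>apply_bcontfun h x\<bar> \<le> \<bar>apply_bcontfun ((norm h / c) *\<^sub>R (\<Sum>d\<in>D. ltrans d k)) x\<bar>"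
    proof (cases "x \<in> K")
      case True
      have "\<bar>apply_bcontfun h x\<bar> \<le> norm h / c * c" using norm_bounded[of h x] D(2) by simp
      also have "\<dots> \<le> norm h / c * (\<Sum>d\<in>D. apply_bcontfun k (- d + x))"
        using D(2) by (intro mult_left_mono D(3) True) auto
      also have "\<dots> = apply_bcontfun ((norm h / c) *\<^sub>R (\<Sum>d\<in>D. ltrans d k)) x" by (simp add: sum_apply)
      finally show ?thesis by linarith
    qed (simp add: K)
  qed
qed

text \<open>The oscillation of \<open>h\<close> has a weight in \<open>Cc\<close>, and this weight
  is dominated by translates of \<open>k\<close> just as \<open>h\<close> is.\<close>

lemma Cc_uniformly_dominated:
  fixes h k :: "'a \<Rightarrow>\<^sub>C real"
  assumes "h \<in> Cc" "k \<in> Cb_ru" "k \<noteq> 0" "\<And>x. 0 \<le> apply_bcontfun k x"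
  shows "h \<in> uniformly_dominated k"
  unfolding uniformly_dominated_def
  using Cc_left_oscillation[OF assms(1)] Cc_dominated[OF _ assms(2-4)] assms(1) by blast

text \<open>A partition of unity made of translates of one bump supported in \<open>U\<close>,
  multiplied by \<open>h\<close>. The piece \<open>F d\<close> lives on the translate of
  \<open>U\<close> by \<open>d\<close>.\<close>

lemma Cc_partition:
  fixes h :: "'a \<Rightarrow>\<^sub>C real"
  assumes h: "h \<in> Cc" "\<And>x. 0 \<le> apply_bcontfun h x" and U: "open U" "0 \<in> U"
  obtains D F where "finite D" "h = (\<Sum>d\<in>D. F d)" "\<And>d. F d \<in> Cc"
    "\<And>d x. 0 \<le> apply_bcontfun (F d) x" "\<And>d x. apply_bcontfun (F d) x \<noteq> 0 \<Longrightarrow> - d + x \<in> U"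
proof -
  obtain K where K: "compact K" "\<And>x. x \<notin> K \<Longrightarrow> apply_bcontfun h x = 0" using h(1) by (rule CcE) blast
  obtain b where b: "b \<in> Cc" "\<And>x. 0 \<le> apply_bcontfun b x" "apply_bcontfun b 0 = 1"
    "\<And>x. x \<notin> U \<Longrightarrow> apply_bcontfun b x = 0"
    using Cc_bump[OF U] by blast
  then have "b \<noteq> 0" by auto
  then obtain D c where D: "finite D" "0 < c" "\<And>x. x \<in> K \<Longrightarrow> c \<le> (\<Sum>d\<in>D. apply_bcontfun b (- d + x))"
    using translates_lower_bound[OF b(2) _ K(1)] by blast
  \<comment> \<open>The maximum with \<open>c\<close> keeps the denominator positive and continuous
    everywhere without changing it on \<open>K\<close>.\<close>
  define S where "S x = max c (\<Sum>d\<in>D. apply_bcontfun b (- d + x))" for x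
  define G where "G d x = apply_bcontfun b (- d + x) / S x" for d x
  have S: "0 < S x" for x using D(2) by (simp add: S_def less_max_iff_disj)
  have contS: "continuous_on UNIV S"
    unfolding S_def
    by (intro continuous_intros continuous_on_compose2[OF continuous_on_apply_bcontfun[of UNIV]]) auto
  have G: "continuous_on UNIV (G d)" for d
    unfolding G_def using S contS
    by (intro continuous_intros continuous_on_compose2[OF continuous_on_apply_bcontfun[of UNIV]])
      (auto simp: less_imp_neq[symmetric])
  show thesis
  proof (rule that[of D "\<lambda>d. Cc_mult h (G d)"])
    show "h = (\<Sum>d\<in>D. Cc_mult h (G d))"
    proof (rule bcontfun_eqI)
      fix x
      show "apply_bcontfun h x = apply_bcontfun (\<Sum>d\<in>D. Cc_mult h (G d)) x"
      proof (cases "x \<in> K")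
        case True
        then have "S x = (\<Sum>d\<in>D. apply_bcontfun b (- d + x))" using D(3) by (simp add: S_def)
        then have "(\<Sum>d\<in>D. G d x) = 1" using S[of x] by (simp add: G_def flip: sum_divide_distrib)
        then show ?thesis by (simp add: sum_apply apply_Cc_mult[OF h(1) G] flip: sum_distrib_left)
      qed (simp add: sum_apply apply_Cc_mult[OF h(1) G] K)
    qed
    show "0 \<le> apply_bcontfun (Cc_mult h (G d)) x" for d x
      using h(2) b(2) S[of x] by (simp add: apply_Cc_mult[OF h(1) G] G_def)
    show "- d + x \<in> U" if "apply_bcontfun (Cc_mult h (G d)) x \<noteq> 0" for d x
      using that b(4) by (auto simp: apply_Cc_mult[OF h(1) G] G_def)
  qed (use D Cc_mult_Cc[OF h(1) G] in auto)
qed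

end

subsection \<open>Haar integrals and convolution\<close>

text \<open>A left Haar measure seen as a functional. Strict positivity excludes the zero functional
  and permits division by the integral of a bump.\<close>

definition haar_integral :: "(('a::topological_group_add \<Rightarrow>\<^sub>C real) \<Rightarrow> real) \<Rightarrow> bool"
  where "haar_integral m \<longleftrightarrow> positive_linear_on Cc m \<and> (\<forall>h\<in>Cc. \<forall>g. m (ltrans g h) = m h) \<and>
    (\<forall>h\<in>Cc. (\<forall>x. 0 \<le> apply_bcontfun h x) \<longrightarrow> h \<noteq> 0 \<longrightarrow> 0 < m h)"

text \<open>In multiplicative notation this is the convolution of \<open>\<phi>\<close> and
  \<open>h\<close> at \<open>x\<close>, the integral of \<open>\<phi> y\<close> times
  \<open>h\<close> at the inverse of \<open>y\<close> times \<open>x\<close>.\<close>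

definition conv :: "(('a::topological_group_add \<Rightarrow>\<^sub>C real) \<Rightarrow> real) \<Rightarrow> ('a \<Rightarrow>\<^sub>C real) \<Rightarrow> ('a \<Rightarrow>\<^sub>C real) \<Rightarrow> 'a \<Rightarrow>\<^sub>C real"
  where "conv m \<phi> h = Bcontfun (\<lambda>x. m (Cc_mult \<phi> (\<lambda>y. apply_bcontfun h (- y + x))))"

lemma continuous_on_reflect:
  fixes h :: "'a::topological_group_add \<Rightarrow>\<^sub>C real"
  shows "continuous_on UNIV (\<lambda>y. apply_bcontfun h (- y + x))"
  by (intro continuous_intros continuous_on_compose2[OF continuous_on_apply_bcontfun[of UNIV]]) auto

text \<open>A bump \<open>b\<close> is uniformly dominated by itself, and so is all of
  \<open>Cc\<close> by \<open>b\<close>; the invariant integral for \<open>b\<close> is restricted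
  to \<open>Cc\<close>. It is strictly positive because \<open>b\<close>, whose integral is 1, lies
  below a finite sum of translates of any nonzero nonnegative \<open>k\<close> in
  \<open>Cc\<close>.\<close>

lemma translate_property_haar_integral:
  assumes lc: "locally_compact_space (euclidean :: 'a::{topological_group_add, t2_space} topology)"
    and tp: "translate_property (Cb_ru :: ('a \<Rightarrow>\<^sub>C real) set)"
  obtains m :: "('a::{topological_group_add, t2_space} \<Rightarrow>\<^sub>C real) \<Rightarrow> real" where "haar_integral m"
proof -
  obtain b :: "'a \<Rightarrow>\<^sub>C real" where b: "b \<in> Cc" "\<And>x. 0 \<le> apply_bcontfun b x" "apply_bcontfun b 0 = 1" "b \<noteq> 0"
    by (rule Cc_bump_zero[OF lc]) blast
  have bC: "b \<in> Cb_ru" using b(1) Cc_subset_Cb_ru[OF lc] by blast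
  have sub: "Cc \<subseteq> uniformly_dominated b"
    using Cc_uniformly_dominated[OF lc _ bC b(4,2)] by blast
  then have "b \<in> uniformly_dominated b" using b(1) by blast
  from invariant_integral_uniformly_dominated[OF tp this b(4,2)]
  obtain m where m: "positive_linear_on (uniformly_dominated b) m"
    "\<And>h g. h \<in> uniformly_dominated b \<Longrightarrow> m (ltrans g h) = m h" "m b = 1" by blast
  have pm: "positive_linear_on Cc m" using m(1) subspace_Cc sub by (rule positive_linear_on_subset)
  have "0 < m k" if k: "k \<in> Cc" "\<And>x. 0 \<le> apply_bcontfun k x" "k \<noteq> 0" for k
  proof -
    have "b \<in> dominated_by_translates Cb_ru k"
      using k Cc_subset_Cb_ru[OF lc] by (intro Cc_dominated[OF lc b(1)]) auto
    then obtain n and g :: "nat \<Rightarrow> 'a"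
      where g: "\<And>x. \<bar>apply_bcontfun b x\<bar> \<le> apply_bcontfun (\<Sum>j<n. ltrans (g j) k) x"
      unfolding dominated_by_translates_def by blast
    have "(\<Sum>j<n. ltrans (g j) k) \<in> Cc" by (intro subspace_sum[OF subspace_Cc] ltrans_Cc k)
    from plin_abs_le[OF pm b(1) this g]
    have "1 \<le> (\<Sum>j<n. m (ltrans (g j) k))"
      using m(3) plin_sum[OF pm, of "{..<n}" "\<lambda>j. ltrans (g j) k"] ltrans_Cc[OF k(1)] by simp
    then have "1 \<le> real n * m k" using m(2) sub k(1) by auto
    moreover have "0 \<le> m k" using pm k(1,2) by (rule plin_nonneg)
    ultimately show ?thesis by (cases "m k = 0") auto
  qed
  then have "haar_integral m"
    unfolding haar_integral_def using pm m(2) sub by blast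
  then show thesis by (rule that)
qed

section \<open>Convolution with respect to a Haar integral\<close>

context
  fixes m :: "('a::{topological_group_add, t2_space} \<Rightarrow>\<^sub>C real) \<Rightarrow> real"
  assumes lc: "locally_compact_space (euclidean :: 'a topology)"
    and haar: "haar_integral m"
begin

lemma haar_plin: "positive_linear_on Cc m"
  using haar by (simp add: haar_integral_def)

lemma haar_ltrans: "h \<in> Cc \<Longrightarrow> m (ltrans g h) = m h"
  using haar by (simp add: haar_integral_def)

lemma haar_pos: "h \<in> Cc \<Longrightarrow> (\<And>x. 0 \<le> apply_bcontfun h x) \<Longrightarrow> h \<noteq> 0 \<Longrightarrow> 0 < m h"
  using haar by (simp add: haar_integral_def)

lemma haar_Cc_mult_le:
  assumes "\<psi> \<in> Cc" "q \<in> Cc" "continuous_on UNIV G" "continuous_on UNIV H"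
    and "\<And>y. \<bar>apply_bcontfun \<psi> y * G y\<bar> \<le> apply_bcontfun q y * H y"
  shows "\<bar>m (Cc_mult \<psi> G)\<bar> \<le> m (Cc_mult q H)"
  using assms by (intro plin_abs_le[OF haar_plin]) (simp_all add: Cc_mult_Cc apply_Cc_mult)

lemma haar_Cc_mult_add_left:
  assumes "\<phi> \<in> Cc" "\<psi> \<in> Cc" "continuous_on UNIV G"
  shows "m (Cc_mult (\<phi> + \<psi>) G) = m (Cc_mult \<phi> G) + m (Cc_mult \<psi> G)"
proof -
  have "Cc_mult (\<phi> + \<psi>) G = Cc_mult \<phi> G + Cc_mult \<psi> G"
    using assms by (intro bcontfun_eqI) (simp add: apply_Cc_mult subspace_add[OF subspace_Cc] distrib_right)
  then show ?thesis using assms by (simp add: plin_add[OF haar_plin] Cc_mult_Cc)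
qed

lemma haar_Cc_mult_scale_left:
  assumes "\<phi> \<in> Cc" "continuous_on UNIV G"
  shows "m (Cc_mult (c *\<^sub>R \<phi>) G) = c * m (Cc_mult \<phi> G)"
proof -
  have "Cc_mult (c *\<^sub>R \<phi>) G = c *\<^sub>R Cc_mult \<phi> G"
    using assms by (intro bcontfun_eqI) (simp add: apply_Cc_mult subspace_scale[OF subspace_Cc])
  then show ?thesis using assms by (simp add: plin_scale[OF haar_plin] Cc_mult_Cc)
qed

lemma haar_Cc_mult_add_right:
  assumes "\<phi> \<in> Cc" "continuous_on UNIV G" "continuous_on UNIV H"
  shows "m (Cc_mult \<phi> (\<lambda>y. G y + H y)) = m (Cc_mult \<phi> G) + m (Cc_mult \<phi> H)"
proof -
  have "Cc_mult \<phi> (\<lambda>y. G y + H y) = Cc_mult \<phi> G + Cc_mult \<phi> H"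
    using assms by (intro bcontfun_eqI) (simp add: apply_Cc_mult continuous_on_add distrib_left)
  then show ?thesis using assms by (simp add: plin_add[OF haar_plin] Cc_mult_Cc)
qed

lemma haar_Cc_mult_scale_right:
  assumes "\<phi> \<in> Cc" "continuous_on UNIV G"
  shows "m (Cc_mult \<phi> (\<lambda>y. c * G y)) = c * m (Cc_mult \<phi> G)"
proof -
  have "Cc_mult \<phi> (\<lambda>y. c * G y) = c *\<^sub>R Cc_mult \<phi> G"
    using assms by (intro bcontfun_eqI) (simp add: apply_Cc_mult continuous_on_mult_left)
  then show ?thesis using assms by (simp add: plin_scale[OF haar_plin] Cc_mult_Cc)
qed

lemma haar_Cc_mult_const: "\<phi> \<in> Cc \<Longrightarrow> m (Cc_mult \<phi> (\<lambda>_. c)) = c * m \<phi>"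
  by (simp add: Cc_mult_const plin_scale[OF haar_plin])

lemma haar_Cc_mult_ltrans:
  assumes "\<phi> \<in> Cc"
  shows "m (Cc_mult (ltrans u \<phi>) (\<lambda>y. apply_bcontfun h (- y + x)))
    = m (Cc_mult \<phi> (\<lambda>y. apply_bcontfun h (- y + (- u + x))))"
proof -
  have "Cc_mult (ltrans u \<phi>) (\<lambda>y. apply_bcontfun h (- y + x))
      = ltrans u (Cc_mult \<phi> (\<lambda>y. apply_bcontfun h (- y + (- u + x))))"
    by (rule bcontfun_eqI)
      (simp add: apply_Cc_mult assms ltrans_Cc continuous_on_reflect minus_add add.assoc del: add_uminus_conv_diff)
  then show ?thesis by (simp add: haar_ltrans Cc_mult_Cc assms continuous_on_reflect)
qed

text \<open>Translating a convolution translates its first factor, so its oscillation is controlled by that factor alone.\<close>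

lemma conv_oscillation_aux:
  assumes \<phi>: "\<phi> \<in> Cc" "p \<in> Cc" "dominated_oscillation \<phi> p"
    and H: "\<And>x. \<bar>apply_bcontfun h x\<bar> \<le> apply_bcontfun H x" and e: "0 < e"
  shows "\<forall>\<^sub>F u in nhds 0. \<forall>x.
    \<bar>m (Cc_mult \<phi> (\<lambda>y. apply_bcontfun h (- y + (- u + x)))) - m (Cc_mult \<phi> (\<lambda>y. apply_bcontfun h (- y + x)))\<bar>
      \<le> e * m (Cc_mult p (\<lambda>y. apply_bcontfun H (- y + x)))"
proof -
  have "\<forall>\<^sub>F u in nhds 0. \<forall>y. \<bar>apply_bcontfun \<phi> (- u + y) - apply_bcontfun \<phi> y\<bar> \<le> e * apply_bcontfun p y"
    using \<phi>(3) e unfolding dominated_oscillation_def by blast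
  then show ?thesis
  proof eventually_elim
    case (elim u)
    show ?case
    proof
      fix x
      let ?hx = "\<lambda>y. apply_bcontfun h (- y + x)" and ?Hx = "\<lambda>y. apply_bcontfun H (- y + x)"
      have d: "ltrans u \<phi> - \<phi> \<in> Cc" by (intro subspace_diff[OF subspace_Cc] ltrans_Cc \<phi>)
      have ep: "e *\<^sub>R p \<in> Cc" by (intro subspace_scale[OF subspace_Cc] \<phi>)
      have "m (Cc_mult \<phi> (\<lambda>y. apply_bcontfun h (- y + (- u + x)))) = m (Cc_mult ((ltrans u \<phi> - \<phi>) + \<phi>) ?hx)"
        using haar_Cc_mult_ltrans[OF \<phi>(1), of u h x] by simp
      also have "\<dots> = m (Cc_mult (ltrans u \<phi> - \<phi>) ?hx) + m (Cc_mult \<phi> ?hx)"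
        by (rule haar_Cc_mult_add_left[OF d \<phi>(1) continuous_on_reflect])
      finally have "\<bar>m (Cc_mult \<phi> (\<lambda>y. apply_bcontfun h (- y + (- u + x)))) - m (Cc_mult \<phi> ?hx)\<bar>
          = \<bar>m (Cc_mult (ltrans u \<phi> - \<phi>) ?hx)\<bar>" by simp
      also have "\<dots> \<le> m (Cc_mult (e *\<^sub>R p) ?Hx)"
      proof (rule haar_Cc_mult_le[OF d ep continuous_on_reflect continuous_on_reflect])
        fix y
        have "\<bar>apply_bcontfun \<phi> (- u + y) - apply_bcontfun \<phi> y\<bar> * \<bar>apply_bcontfun h (- y + x)\<bar>
            \<le> (e * apply_bcontfun p y) * apply_bcontfun H (- y + x)"
          using elim H dominated_oscillation_nonneg[OF \<phi>(3)] e by (intro mult_mono) auto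
        then show "\<bar>apply_bcontfun (ltrans u \<phi> - \<phi>) y * apply_bcontfun h (- y + x)\<bar>
            \<le> apply_bcontfun (e *\<^sub>R p) y * apply_bcontfun H (- y + x)"
          by (simp add: abs_mult)
      qed
      also have "\<dots> = e * m (Cc_mult p ?Hx)"
        by (rule haar_Cc_mult_scale_left[OF \<phi>(2) continuous_on_reflect])
      finally show "\<bar>m (Cc_mult \<phi> (\<lambda>y. apply_bcontfun h (- y + (- u + x)))) - m (Cc_mult \<phi> ?hx)\<bar>
          \<le> e * m (Cc_mult p ?Hx)" .
    qed
  qed
qed

text \<open>With the constant \<open>norm h\<close> as majorant of \<open>h\<close>, the oscillation
  of \<open>\<phi>\<close> with weight \<open>p\<close> gives an oscillation of the convolution of
  at most \<open>e * (norm h * m p)\<close>, so the function inside \<open>Bcontfun\<close> is in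
  \<open>Cb_ru\<close>.\<close>

lemma
  assumes \<phi>: "\<phi> \<in> Cc"
  shows apply_conv: "apply_bcontfun (conv m \<phi> h) x = m (Cc_mult \<phi> (\<lambda>y. apply_bcontfun h (- y + x)))"
    and conv_Cb_ru: "conv m \<phi> h \<in> Cb_ru"
proof -
  let ?c = "\<lambda>x. m (Cc_mult \<phi> (\<lambda>y. apply_bcontfun h (- y + x)))"
  let ?H = "const_bcontfun (norm h) :: 'a \<Rightarrow>\<^sub>C real"
  have hH: "\<bar>apply_bcontfun h x\<bar> \<le> apply_bcontfun ?H x" for x using norm_bounded[of h x] by simp
  obtain p where p: "p \<in> Cc" "dominated_oscillation \<phi> p" by (rule Cc_left_oscillation[OF lc \<phi>]) blast
  obtain q where q: "q \<in> Cc" "\<And>x. \<bar>apply_bcontfun \<phi> x\<bar> \<le> apply_bcontfun q x"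
    by (rule Cc_majorant[OF lc \<phi>]) blast
  have bound: "\<bar>?c x\<bar> \<le> norm h * m q" for x
  proof -
    have "\<bar>?c x\<bar> \<le> m (Cc_mult q (\<lambda>_. norm h))"
    proof (rule haar_Cc_mult_le[OF \<phi> q(1) continuous_on_reflect continuous_on_const])
      fix y
      have "0 \<le> apply_bcontfun q y" using q(2)[of y] by linarith
      then show "\<bar>apply_bcontfun \<phi> y * apply_bcontfun h (- y + x)\<bar> \<le> apply_bcontfun q y * norm h"
        using q(2)[of y] norm_bounded[of h "- y + x"] by (simp add: abs_mult mult_mono)
    qed
    then show ?thesis by (simp add: haar_Cc_mult_const q)
  qed
  have mp: "0 \<le> m p" by (rule plin_nonneg[OF haar_plin p(1) dominated_oscillation_nonneg[OF p(2)]])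
  have "\<forall>\<^sub>F u in nhds 0. \<forall>x. \<bar>?c (- u + x) - ?c x\<bar> \<le> e" if e: "0 < e" for e
  proof -
    define B where "B = norm h * m p + 1"
    have B: "0 < B" using mp by (simp add: B_def add_nonneg_pos)
    have "\<forall>\<^sub>F u in nhds 0. \<forall>x. \<bar>?c (- u + x) - ?c x\<bar> \<le> e / B * m (Cc_mult p (\<lambda>y. apply_bcontfun ?H (- y + x)))"
      by (rule conv_oscillation_aux[OF \<phi> p hH]) (use e B in simp)
    then show ?thesis
    proof eventually_elim
      case (elim u)
      have "e / B * m (Cc_mult p (\<lambda>y. apply_bcontfun ?H (- y + x))) \<le> e" for x
      proof -
        have "e / B * m (Cc_mult p (\<lambda>y. apply_bcontfun ?H (- y + x))) \<le> e / B * B"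
          using e B by (intro mult_left_mono) (auto simp: haar_Cc_mult_const p B_def)
        then show ?thesis using B by simp
      qed
      then show ?case using elim order_trans by blast
    qed
  qed
  then obtain k where k: "k \<in> Cb_ru" "\<And>x. apply_bcontfun k x = ?c x"
    using Cb_ru_obtain[of ?c "norm h * m q"] bound by blast
  have "conv m \<phi> h = k" unfolding conv_def k(2)[symmetric] by (simp add: apply_bcontfun_inverse)
  then show "apply_bcontfun (conv m \<phi> h) x = ?c x" "conv m \<phi> h \<in> Cb_ru" using k by simp_all
qed

text \<open>This is the purpose of smoothing: the weight for the convolution is built from a weight
  for \<open>\<phi>\<close> and a mere majorant of \<open>h\<close>, with no weight for
  \<open>h\<close> itself.\<close>

lemma dominated_oscillation_conv:
  assumes "\<phi> \<in> Cc" "p \<in> Cc" "dominated_oscillation \<phi> p"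
    and "\<And>x. \<bar>apply_bcontfun h x\<bar> \<le> apply_bcontfun H x"
  shows "dominated_oscillation (conv m \<phi> h) (conv m p H)"
  unfolding dominated_oscillation_def
  using conv_oscillation_aux[OF assms] by (simp add: apply_conv assms)

lemma ltrans_conv: "\<phi> \<in> Cc \<Longrightarrow> ltrans u (conv m \<phi> h) = conv m (ltrans u \<phi>) h"
  by (rule bcontfun_eqI) (simp add: apply_conv ltrans_Cc haar_Cc_mult_ltrans)

lemma conv_add_left: "\<phi> \<in> Cc \<Longrightarrow> \<psi> \<in> Cc \<Longrightarrow> conv m (\<phi> + \<psi>) h = conv m \<phi> h + conv m \<psi> h"
  by (rule bcontfun_eqI)
    (simp add: apply_conv subspace_add[OF subspace_Cc] haar_Cc_mult_add_left continuous_on_reflect)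

lemma conv_scale_left: "\<phi> \<in> Cc \<Longrightarrow> conv m (c *\<^sub>R \<phi>) h = c *\<^sub>R conv m \<phi> h"
  by (rule bcontfun_eqI)
    (simp add: apply_conv subspace_scale[OF subspace_Cc] haar_Cc_mult_scale_left continuous_on_reflect)

lemma conv_add_right: "\<phi> \<in> Cc \<Longrightarrow> conv m \<phi> (h + k) = conv m \<phi> h + conv m \<phi> k"
  by (rule bcontfun_eqI) (simp add: apply_conv haar_Cc_mult_add_right continuous_on_reflect)

lemma conv_scale_right: "\<phi> \<in> Cc \<Longrightarrow> conv m \<phi> (c *\<^sub>R h) = c *\<^sub>R conv m \<phi> h"
  by (rule bcontfun_eqI) (simp add: apply_conv haar_Cc_mult_scale_right continuous_on_reflect)

lemma conv_zero_left: "conv m 0 h = 0"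
  using conv_scale_left[OF subspace_0[OF subspace_Cc], of 0 h] by simp

lemma conv_zero_right: "\<phi> \<in> Cc \<Longrightarrow> conv m \<phi> 0 = 0"
  using conv_scale_right[of \<phi> 0 0] by simp

lemma conv_sum_left: "(\<And>i. i \<in> A \<Longrightarrow> F i \<in> Cc) \<Longrightarrow> conv m (sum F A) h = (\<Sum>i\<in>A. conv m (F i) h)"
  by (induction A rule: infinite_finite_induct)
    (auto simp: conv_zero_left conv_add_left subspace_sum[OF subspace_Cc])

lemma conv_sum_right: "\<phi> \<in> Cc \<Longrightarrow> conv m \<phi> (sum F A) = (\<Sum>i\<in>A. conv m \<phi> (F i))"
  by (induction A rule: infinite_finite_induct) (auto simp: conv_zero_right conv_add_right)

lemma conv_abs_le:
  assumes "\<phi> \<in> Cc" "q \<in> Cc" "\<And>x. \<bar>apply_bcontfun \<phi> x\<bar> \<le> apply_bcontfun q x"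
    and "\<And>x. \<bar>apply_bcontfun h x\<bar> \<le> apply_bcontfun H x"
  shows "\<bar>apply_bcontfun (conv m \<phi> h) x\<bar> \<le> apply_bcontfun (conv m q H) x"
  unfolding apply_conv[OF assms(1)] apply_conv[OF assms(2)]
proof (rule haar_Cc_mult_le[OF assms(1,2) continuous_on_reflect continuous_on_reflect])
  fix y
  have "0 \<le> apply_bcontfun q y" using assms(3)[of y] by linarith
  then show "\<bar>apply_bcontfun \<phi> y * apply_bcontfun h (- y + x)\<bar> \<le> apply_bcontfun q y * apply_bcontfun H (- y + x)"
    using assms(3)[of y] assms(4)[of "- y + x"] by (simp add: abs_mult mult_mono)
qed

text \<open>With each function as its own majorant, the estimate bounds the absolute value of the
  convolution by the convolution.\<close>

lemma conv_nonneg: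
  assumes "\<phi> \<in> Cc" "\<And>x. 0 \<le> apply_bcontfun \<phi> x" "\<And>x. 0 \<le> apply_bcontfun h x"
  shows "0 \<le> apply_bcontfun (conv m \<phi> h) x"
  using conv_abs_le[of \<phi> \<phi> h h x] assms by force

lemma conv_Cc:
  assumes "\<phi> \<in> Cc" "\<psi> \<in> Cc" shows "conv m \<phi> \<psi> \<in> Cc"
proof -
  obtain K where K: "compact K" "\<And>x. x \<notin> K \<Longrightarrow> apply_bcontfun \<phi> x = 0" using assms(1) by (rule CcE) blast
  obtain L where L: "compact L" "\<And>x. x \<notin> L \<Longrightarrow> apply_bcontfun \<psi> x = 0" using assms(2) by (rule CcE) blast
  have "compact ((\<lambda>z. fst z + snd z) ` (K \<times> L))"
    using K L by (intro compact_continuous_image compact_Times continuous_intros)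
  then show ?thesis
  proof (rule CcI)
    fix x assume x: "x \<notin> (\<lambda>z. fst z + snd z) ` (K \<times> L)"
    have "apply_bcontfun \<phi> y * apply_bcontfun \<psi> (- y + x) = 0" for y
    proof (cases "y \<in> K \<and> - y + x \<in> L")
      case True
      then have "y + (- y + x) \<in> (\<lambda>z. fst z + snd z) ` (K \<times> L)" by force
      then show ?thesis using x by simp
    qed (use K L in auto)
    then have "Cc_mult \<phi> (\<lambda>y. apply_bcontfun \<psi> (- y + x)) = 0"
      by (intro bcontfun_eqI) (simp add: apply_Cc_mult assms continuous_on_reflect)
    then show "apply_bcontfun (conv m \<phi> \<psi>) x = 0"
      by (simp add: apply_conv assms plin_zero[OF haar_plin])
  qed
qed

text \<open>The integral of \<open>\<phi> * k\<close> is a Riemann sum of integrals of translates of \<open>k\<close>, up to a small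
  multiple of a translate-dominated function; no Fubini theorem for the functional is needed.\<close>

lemma integral_conv:
  assumes I: "positive_linear_on V I"
    and V: "\<And>h g. h \<in> V \<Longrightarrow> ltrans g h \<in> V" and inv: "\<And>h g. h \<in> V \<Longrightarrow> I (ltrans g h) = I h"
    and \<phi>: "\<phi> \<in> Cc" "\<And>x. 0 \<le> apply_bcontfun \<phi> x"
    and k: "k \<in> V" "P \<in> V" "dominated_oscillation k P" and conv: "conv m \<phi> k \<in> V"
  shows "I (conv m \<phi> k) = m \<phi> * I k"
proof -
  have sub: "subspace V" by (rule plin_subspace[OF I])
  have mF: "0 \<le> m F" if "F \<in> Cc" "\<And>x. 0 \<le> apply_bcontfun F x" for F
    using that by (rule plin_nonneg[OF haar_plin])
  have est: "\<bar>I (conv m \<phi> k) - m \<phi> * I k\<bar> \<le> e * (m \<phi> * I P)" if e: "0 < e" for e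
  proof -
    have "\<forall>\<^sub>F u in nhds 0. \<forall>x. \<bar>apply_bcontfun k (- u + x) - apply_bcontfun k x\<bar> \<le> e * apply_bcontfun P x"
      using k(3) e unfolding dominated_oscillation_def by blast
    then obtain U where U: "open U" "0 \<in> U"
      "\<And>u x. u \<in> U \<Longrightarrow> \<bar>apply_bcontfun k (- u + x) - apply_bcontfun k x\<bar> \<le> e * apply_bcontfun P x"
      unfolding eventually_nhds by blast
    \<comment> \<open>Each piece of \<open>\<phi>\<close> is concentrated so near its node
      \<open>d\<close> that in its convolution with \<open>k\<close> the translate
      \<open>ltrans d k\<close> can be taken out.\<close>
    obtain D F where D: "finite D" "\<phi> = (\<Sum>d\<in>D. F d)" and F: "\<And>d. F d \<in> Cc"
      "\<And>d x. 0 \<le> apply_bcontfun (F d) x" "\<And>d x. apply_bcontfun (F d) x \<noteq> 0 \<Longrightarrow> - d + x \<in> U"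
      by (rule Cc_partition[OF lc \<phi> U(1,2)]) blast
    have m\<phi>: "(\<Sum>d\<in>D. m (F d)) = m \<phi>"
      unfolding D(2) by (rule plin_sum[OF haar_plin, symmetric]) (rule F)
    \<comment> \<open>\<open>s\<close> is the Riemann sum for the convolution, and \<open>e\<close>
      times \<open>S\<close> will bound the error; invariance of \<open>I\<close> makes both
      integrals explicit.\<close>
    define s where "s = (\<Sum>d\<in>D. m (F d) *\<^sub>R ltrans d k)"
    define S where "S = (\<Sum>d\<in>D. m (F d) *\<^sub>R ltrans d P)"
    have sV: "s \<in> V" "S \<in> V"
      unfolding s_def S_def by (intro subspace_sum[OF sub] subspace_scale[OF sub] V k)+
    have Is: "I s = m \<phi> * I k"
      unfolding s_def by (subst plin_sum[OF I])
        (simp_all add: subspace_scale[OF sub] V k plin_scale[OF I] inv flip: sum_distrib_right m\<phi>)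
    have IS: "I S = m \<phi> * I P"
      unfolding S_def by (subst plin_sum[OF I])
        (simp_all add: subspace_scale[OF sub] V k plin_scale[OF I] inv flip: sum_distrib_right m\<phi>)
    have "\<bar>apply_bcontfun (conv m \<phi> k - s) x\<bar> \<le> apply_bcontfun (e *\<^sub>R S) x" for x
    proof -
      have piece: "\<bar>apply_bcontfun (conv m (F d) k) x - m (F d) * apply_bcontfun k (- d + x)\<bar>
          \<le> e * (m (F d) * apply_bcontfun P (- d + x))" for d
      proof -
        let ?kx = "\<lambda>y. apply_bcontfun k (- y + x)"
        let ?a = "apply_bcontfun k (- d + x)"
        have "m (Cc_mult (F d) (\<lambda>y. ?kx y + - ?a)) = m (Cc_mult (F d) ?kx) + m (Cc_mult (F d) (\<lambda>_. - ?a))"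
          by (rule haar_Cc_mult_add_right[OF F(1) continuous_on_reflect continuous_on_const])
        then have "apply_bcontfun (conv m (F d) k) x - m (F d) * ?a = m (Cc_mult (F d) (\<lambda>y. ?kx y + - ?a))"
          by (simp add: apply_conv F haar_Cc_mult_const)
        also have "\<bar>\<dots>\<bar> \<le> m (Cc_mult (F d) (\<lambda>_. e * apply_bcontfun P (- d + x)))"
        proof (rule haar_Cc_mult_le[OF F(1) F(1)])
          show "continuous_on UNIV (\<lambda>y. ?kx y + - ?a)"
            by (intro continuous_on_add continuous_on_reflect continuous_on_const)
          fix y
          show "\<bar>apply_bcontfun (F d) y * (?kx y + - ?a)\<bar> \<le> apply_bcontfun (F d) y * (e * apply_bcontfun P (- d + x))"
          proof (cases "apply_bcontfun (F d) y = 0")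
            case False
            \<comment> \<open>With \<open>u = - d + y\<close>, which is in \<open>U\<close>, the
              point \<open>- y + x\<close> is \<open>- u + (- d + x)\<close>.\<close>
            then have "\<bar>?kx y + - ?a\<bar> \<le> e * apply_bcontfun P (- d + x)"
              using U(3)[OF F(3)[OF False], of "- d + x"]
              by (simp add: minus_add add.assoc del: add_uminus_conv_diff)
            then show ?thesis using F(2)[of d y] by (simp add: abs_mult mult_left_mono)
          qed simp
        qed (rule continuous_on_const)
        finally show ?thesis by (simp add: haar_Cc_mult_const F mult_ac)
      qed
      have "apply_bcontfun (conv m \<phi> k - s) x
          = (\<Sum>d\<in>D. apply_bcontfun (conv m (F d) k) x - m (F d) * apply_bcontfun k (- d + x))"
        unfolding s_def D(2) by (simp add: conv_sum_left F sum_apply sum_subtractf)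
      also have "\<bar>\<dots>\<bar> \<le> (\<Sum>d\<in>D. e * (m (F d) * apply_bcontfun P (- d + x)))"
        by (rule order_trans[OF sum_abs sum_mono]) (rule piece)
      finally show ?thesis by (simp add: S_def sum_apply sum_distrib_left)
    qed
    from plin_abs_le[OF I subspace_diff[OF sub conv sV(1)] subspace_scale[OF sub sV(2)] this]
    show ?thesis by (simp add: plin_diff[OF I conv sV(1)] Is IS plin_scale[OF I sV(2)])
  qed
  have "\<bar>I (conv m \<phi> k) - m \<phi> * I k\<bar> \<le> 0"
  proof (rule field_le_epsilon)
    fix e :: real assume e: "0 < e"
    have A: "0 \<le> m \<phi> * I P"
      using mF[OF \<phi>] plin_nonneg[OF I k(2) dominated_oscillation_nonneg[OF k(3)]] by simp
    have "e / (m \<phi> * I P + 1) * (m \<phi> * I P) \<le> e / (m \<phi> * I P + 1) * (m \<phi> * I P + 1)"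
      using e A by (intro mult_left_mono) auto
    also have "\<dots> = e" using A by simp
    finally show "\<bar>I (conv m \<phi> k) - m \<phi> * I k\<bar> \<le> 0 + e"
      using est[of "e / (m \<phi> * I P + 1)"] e A by simp
  qed
  then show ?thesis by simp
qed

text \<open>By left invariance and the symmetry of \<open>\<psi>\<close>, \<open>(\<phi> * \<psi>)(x) = \<integral> \<phi>(x + z) \<psi>(z) dz\<close>.\<close>

lemma conv_right_approx:
  assumes \<phi>: "\<phi> \<in> Cc"
    and U: "\<And>u x. u \<in> U \<Longrightarrow> \<bar>apply_bcontfun \<phi> (x + u) - apply_bcontfun \<phi> x\<bar> \<le> e * apply_bcontfun p x"
    and \<psi>: "\<psi> \<in> Cc" "\<And>x. 0 \<le> apply_bcontfun \<psi> x" "\<And>x. apply_bcontfun \<psi> (- x) = apply_bcontfun \<psi> x"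
      "\<And>x. x \<notin> U \<Longrightarrow> apply_bcontfun \<psi> x = 0"
  shows "\<bar>apply_bcontfun (conv m \<phi> \<psi>) x - m \<psi> * apply_bcontfun \<phi> x\<bar> \<le> e * m \<psi> * apply_bcontfun p x"
proof -
  let ?G = "\<lambda>z. apply_bcontfun \<phi> (x + z)" and ?a = "apply_bcontfun \<phi> x"
  have G: "continuous_on UNIV ?G"
    by (intro continuous_intros continuous_on_compose2[OF continuous_on_apply_bcontfun[of UNIV]]) auto
  have "apply_bcontfun \<psi> (- y + x) = apply_bcontfun \<psi> (- x + y)" for y
    using \<psi>(3)[of "- x + y"] by (simp add: minus_add del: add_uminus_conv_diff)
  then have "apply_bcontfun (Cc_mult \<phi> (\<lambda>y. apply_bcontfun \<psi> (- y + x))) y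
      = apply_bcontfun (ltrans x (Cc_mult \<psi> ?G)) y" for y
    unfolding apply_Cc_mult[OF \<phi> continuous_on_reflect] apply_ltrans apply_Cc_mult[OF \<psi>(1) G] by simp
  then have "Cc_mult \<phi> (\<lambda>y. apply_bcontfun \<psi> (- y + x)) = ltrans x (Cc_mult \<psi> ?G)"
    by (rule bcontfun_eqI)
  then have "apply_bcontfun (conv m \<phi> \<psi>) x = m (Cc_mult \<psi> ?G)"
    by (simp add: apply_conv \<phi> haar_ltrans Cc_mult_Cc \<psi>(1) G)
  moreover have "m (Cc_mult \<psi> (\<lambda>z. ?G z + - ?a)) = m (Cc_mult \<psi> ?G) + m (Cc_mult \<psi> (\<lambda>_. - ?a))"
    by (rule haar_Cc_mult_add_right[OF \<psi>(1) G continuous_on_const])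
  ultimately have "apply_bcontfun (conv m \<phi> \<psi>) x - m \<psi> * ?a = m (Cc_mult \<psi> (\<lambda>z. ?G z + - ?a))"
    by (simp add: haar_Cc_mult_const \<psi>(1))
  also have "\<bar>\<dots>\<bar> \<le> m (Cc_mult \<psi> (\<lambda>_. e * apply_bcontfun p x))"
  proof (rule haar_Cc_mult_le[OF \<psi>(1) \<psi>(1)])
    show "continuous_on UNIV (\<lambda>z. ?G z + - ?a)" by (intro continuous_on_add G continuous_on_const)
    fix z
    show "\<bar>apply_bcontfun \<psi> z * (?G z + - ?a)\<bar> \<le> apply_bcontfun \<psi> z * (e * apply_bcontfun p x)"
      using U[of z x] \<psi>(2)[of z] \<psi>(4)[of z] by (cases "z \<in> U") (simp_all add: abs_mult mult_left_mono)
  qed (rule continuous_on_const)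
  finally show ?thesis
    by (simp add: haar_Cc_mult_const \<psi>(1) mult_ac)
qed

section \<open>Uniqueness of the Haar integral and the modular function\<close>

text \<open>For a symmetric \<open>\<psi>\<close> concentrated near 0,
  \<open>\<Phi> (conv m \<phi> \<psi>)\<close> is computed in two ways: it equals
  \<open>m \<phi> * \<Phi> \<psi>\<close> by the integral formula for convolutions, and it is close
  to \<open>m \<psi> * \<Phi> \<phi>\<close> because \<open>\<psi>\<close> acts as an approximate
  identity. So the ratio of \<open>\<Phi>\<close> to \<open>m\<close> is nearly the same at
  \<open>\<phi>\<close>, \<open>\<eta>\<close> and \<open>\<psi>\<close>.\<close>

lemma haar_unique:
  assumes \<Phi>: "positive_linear_on Cc \<Phi>" and inv: "\<And>h g. h \<in> Cc \<Longrightarrow> \<Phi> (ltrans g h) = \<Phi> h"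
    and \<phi>: "\<phi> \<in> Cc" "\<And>x. 0 \<le> apply_bcontfun \<phi> x" and \<eta>: "\<eta> \<in> Cc" "\<And>x. 0 \<le> apply_bcontfun \<eta> x"
  shows "\<Phi> \<phi> * m \<eta> = \<Phi> \<eta> * m \<phi>"
proof -
  obtain p where p: "p \<in> Cc"
    "\<And>e. 0 < e \<Longrightarrow> \<forall>\<^sub>F u in nhds 0. \<forall>x. \<bar>apply_bcontfun \<phi> (x + u) - apply_bcontfun \<phi> x\<bar> \<le> e * apply_bcontfun p x"
    by (rule Cc_right_oscillation[OF lc \<phi>(1)]) blast
  obtain q where q: "q \<in> Cc"
    "\<And>e. 0 < e \<Longrightarrow> \<forall>\<^sub>F u in nhds 0. \<forall>x. \<bar>apply_bcontfun \<eta> (x + u) - apply_bcontfun \<eta> x\<bar> \<le> e * apply_bcontfun q x"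
    by (rule Cc_right_oscillation[OF lc \<eta>(1)]) blast
  define A where "A = \<Phi> p * m \<eta> + \<Phi> q * m \<phi>"
  have m0: "0 \<le> m \<phi>" "0 \<le> m \<eta>" using \<phi> \<eta> by (auto intro: plin_nonneg[OF haar_plin])
  have est: "\<bar>\<Phi> \<phi> * m \<eta> - \<Phi> \<eta> * m \<phi>\<bar> \<le> e * A" if e: "0 < e" for e
  proof -
    obtain U where U: "open U" "0 \<in> U"
      "\<And>u x. u \<in> U \<Longrightarrow> \<bar>apply_bcontfun \<phi> (x + u) - apply_bcontfun \<phi> x\<bar> \<le> e * apply_bcontfun p x"
      "\<And>u x. u \<in> U \<Longrightarrow> \<bar>apply_bcontfun \<eta> (x + u) - apply_bcontfun \<eta> x\<bar> \<le> e * apply_bcontfun q x"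
      using eventually_conj[OF p(2)[OF e] q(2)[OF e]] unfolding eventually_nhds by blast
    obtain b where b: "b \<in> Cc" "\<And>x. 0 \<le> apply_bcontfun b x" "apply_bcontfun b 0 = 1"
      "\<And>x. x \<notin> U \<Longrightarrow> apply_bcontfun b x = 0"
      by (rule Cc_bump[OF lc U(1,2)]) blast
    have c: "continuous_on UNIV (\<lambda>x. apply_bcontfun b (- x))"
      using continuous_on_reflect[of b 0] by simp
    \<comment> \<open>The product with the reflected bump is symmetric, still vanishes outside
      \<open>U\<close> and still has the value 1 at 0.\<close>
    define \<psi> where "\<psi> = Cc_mult b (\<lambda>x. apply_bcontfun b (- x))"
    have app: "apply_bcontfun \<psi> x = apply_bcontfun b x * apply_bcontfun b (- x)" for x
      unfolding \<psi>_def by (rule apply_Cc_mult[OF b(1) c])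
    have \<psi>: "\<psi> \<in> Cc" "\<And>x. 0 \<le> apply_bcontfun \<psi> x" "\<And>x. apply_bcontfun \<psi> (- x) = apply_bcontfun \<psi> x"
      "\<And>x. x \<notin> U \<Longrightarrow> apply_bcontfun \<psi> x = 0"
      using Cc_mult_Cc[OF b(1) c] b by (auto simp: \<psi>_def[symmetric] app)
    have "apply_bcontfun \<psi> 0 = 1" using b by (simp add: app)
    then have "\<psi> \<noteq> 0" by auto
    then have pos: "0 < m \<psi>" using \<psi> by (intro haar_pos)
    have fub: "\<Phi> (conv m \<theta> \<psi>) = m \<theta> * \<Phi> \<psi>" if "\<theta> \<in> Cc" "\<And>x. 0 \<le> apply_bcontfun \<theta> x" for \<theta>
    proof -
      obtain r where "r \<in> Cc" "dominated_oscillation \<psi> r" by (rule Cc_left_oscillation[OF lc \<psi>(1)]) blast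
      then show ?thesis
        using that \<psi>(1) by (intro integral_conv[OF \<Phi>] ltrans_Cc inv conv_Cc)
    qed
    have close: "\<bar>m \<theta> * \<Phi> \<psi> - m \<psi> * \<Phi> \<theta>\<bar> \<le> e * m \<psi> * \<Phi> r"
      if \<theta>: "\<theta> \<in> Cc" "\<And>x. 0 \<le> apply_bcontfun \<theta> x" and r: "r \<in> Cc"
        "\<And>x. \<bar>apply_bcontfun (conv m \<theta> \<psi>) x - m \<psi> * apply_bcontfun \<theta> x\<bar> \<le> e * m \<psi> * apply_bcontfun r x" for \<theta> r
    proof -
      have C: "conv m \<theta> \<psi> \<in> Cc" "m \<psi> *\<^sub>R \<theta> \<in> Cc" "(e * m \<psi>) *\<^sub>R r \<in> Cc"
        using \<theta>(1) r(1) \<psi>(1) conv_Cc subspace_scale[OF subspace_Cc] by blast+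
      have "\<bar>\<Phi> (conv m \<theta> \<psi> - m \<psi> *\<^sub>R \<theta>)\<bar> \<le> \<Phi> ((e * m \<psi>) *\<^sub>R r)"
        by (rule plin_abs_le[OF \<Phi> subspace_diff[OF subspace_Cc C(1,2)] C(3)]) (simp add: r(2))
      then show ?thesis
        by (simp add: plin_diff[OF \<Phi> C(1,2)] plin_scale[OF \<Phi>] \<theta>(1) r(1) fub[OF \<theta>])
    qed
    have 1: "\<bar>m \<phi> * \<Phi> \<psi> - m \<psi> * \<Phi> \<phi>\<bar> \<le> e * m \<psi> * \<Phi> p"
      by (rule close[OF \<phi> p(1)]) (rule conv_right_approx[OF \<phi>(1) U(3) \<psi>])
    have 2: "\<bar>m \<eta> * \<Phi> \<psi> - m \<psi> * \<Phi> \<eta>\<bar> \<le> e * m \<psi> * \<Phi> q"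
      by (rule close[OF \<eta> q(1)]) (rule conv_right_approx[OF \<eta>(1) U(4) \<psi>])
    \<comment> \<open>The combination is chosen to eliminate \<open>\<Phi> \<psi>\<close>, over
      which there is no control as \<open>\<psi>\<close> shrinks.\<close>
    have "m \<psi> * (\<Phi> \<phi> * m \<eta> - \<Phi> \<eta> * m \<phi>)
        = m \<phi> * (m \<eta> * \<Phi> \<psi> - m \<psi> * \<Phi> \<eta>) - m \<eta> * (m \<phi> * \<Phi> \<psi> - m \<psi> * \<Phi> \<phi>)"
      by (simp add: algebra_simps)
    also have "\<bar>\<dots>\<bar> \<le> m \<phi> * \<bar>m \<eta> * \<Phi> \<psi> - m \<psi> * \<Phi> \<eta>\<bar> + m \<eta> * \<bar>m \<phi> * \<Phi> \<psi> - m \<psi> * \<Phi> \<phi>\<bar>"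
      using m0 by (metis abs_mult abs_of_nonneg abs_triangle_ineq4)
    also have "\<dots> \<le> m \<phi> * (e * m \<psi> * \<Phi> q) + m \<eta> * (e * m \<psi> * \<Phi> p)"
      by (intro add_mono mult_left_mono 1 2 m0)
    also have "\<dots> = m \<psi> * (e * A)" by (simp add: A_def algebra_simps)
    finally show ?thesis using pos by (simp add: abs_mult)
  qed
  have "\<bar>\<Phi> \<phi> * m \<eta> - \<Phi> \<eta> * m \<phi>\<bar> \<le> 0"
  proof (rule field_le_epsilon)
    fix e :: real assume e: "0 < e"
    have "e / (\<bar>A\<bar> + 1) * A \<le> e / (\<bar>A\<bar> + 1) * (\<bar>A\<bar> + 1)"
      using e by (intro mult_left_mono) auto
    also have "\<dots> = e" by simp
    finally show "\<bar>\<Phi> \<phi> * m \<eta> - \<Phi> \<eta> * m \<phi>\<bar> \<le> 0 + e"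
      using est[of "e / (\<bar>A\<bar> + 1)"] e by simp
  qed
  then show ?thesis by simp
qed

text \<open>Right translations commute with left ones, so \<open>h \<mapsto> m (rtrans g h)\<close>
  is again left invariant, and uniqueness makes it proportional to \<open>m\<close>. The factor
  \<open>\<delta>\<close> depends on \<open>g\<close>; it is the modular function at
  \<open>g\<close>, up to convention.\<close>

lemma haar_modular:
  obtains \<delta> where "\<And>h. h \<in> Cc \<Longrightarrow> (\<And>x. 0 \<le> apply_bcontfun h x) \<Longrightarrow> m (rtrans g h) = \<delta> * m h"
proof -
  have add: "rtrans g (h + k) = rtrans g h + rtrans g k" for h k :: "'a \<Rightarrow>\<^sub>C real" by (rule bcontfun_eqI) simp
  have scale: "rtrans g (c *\<^sub>R h) = c *\<^sub>R rtrans g h" for c and h :: "'a \<Rightarrow>\<^sub>C real" by (rule bcontfun_eqI) simp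
  have "positive_linear_on Cc (\<lambda>h. m (rtrans g h))"
    unfolding positive_linear_on_def
    by (auto simp: subspace_Cc add scale plin_add[OF haar_plin] plin_scale[OF haar_plin] rtrans_Cc
        intro!: plin_nonneg[OF haar_plin])
  moreover have "m (rtrans g (ltrans u h)) = m (rtrans g h)" if "h \<in> Cc" for u h
  proof -
    have "rtrans g (ltrans u h) = ltrans u (rtrans g h)" by (rule bcontfun_eqI) (simp add: add.assoc)
    then show ?thesis using that by (simp add: haar_ltrans rtrans_Cc)
  qed
  moreover obtain b :: "'a \<Rightarrow>\<^sub>C real" where b: "b \<in> Cc" "\<And>x. 0 \<le> apply_bcontfun b x" "apply_bcontfun b 0 = 1" "b \<noteq> 0"
    by (rule Cc_bump_zero[OF lc]) blast
  ultimately have "m (rtrans g h) * m b = m (rtrans g b) * m h" if "h \<in> Cc" "\<And>x. 0 \<le> apply_bcontfun h x" for h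
    using that by (intro haar_unique) auto
  moreover have "0 < m b" using b by (intro haar_pos)
  ultimately show thesis by (intro that[of "m (rtrans g b) / m b"]) (simp add: field_simps)
qed

text \<open>Substituting \<open>y + g\<close> for \<open>y\<close> moves the translation from the
  second factor to a right translation of the first, at the cost of the modular factor. The signs of
  \<open>q\<close> and \<open>f\<close> make the integrand nonnegative, as the assumption on
  \<open>\<delta>\<close> demands.\<close>

lemma conv_ltrans_right:
  assumes \<delta>: "\<And>h. h \<in> Cc \<Longrightarrow> (\<And>x. 0 \<le> apply_bcontfun h x) \<Longrightarrow> m (rtrans g h) = \<delta> * m h"
    and q: "q \<in> Cc" "\<And>x. 0 \<le> apply_bcontfun q x" and f: "\<And>x. 0 \<le> apply_bcontfun f x"
  shows "conv m q (ltrans g f) = \<delta> *\<^sub>R conv m (rtrans (- g) q) f"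
proof (rule bcontfun_eqI)
  fix x
  let ?k = "Cc_mult (rtrans (- g) q) (\<lambda>y. apply_bcontfun f (- y + x))"
  have r: "rtrans (- g) q \<in> Cc" by (rule rtrans_Cc[OF q(1)])
  have k: "?k \<in> Cc" by (rule Cc_mult_Cc[OF r continuous_on_reflect])
  have "apply_bcontfun (Cc_mult q (\<lambda>y. apply_bcontfun (ltrans g f) (- y + x))) y = apply_bcontfun (rtrans g ?k) y" for y
    unfolding apply_Cc_mult[OF q(1) continuous_on_reflect] apply_rtrans apply_Cc_mult[OF r continuous_on_reflect]
    by (simp add: minus_add add.assoc del: add_uminus_conv_diff)
  then have "Cc_mult q (\<lambda>y. apply_bcontfun (ltrans g f) (- y + x)) = rtrans g ?k"
    by (rule bcontfun_eqI)
  moreover have "m (rtrans g ?k) = \<delta> * m ?k"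
    by (rule \<delta>[OF k]) (simp add: apply_Cc_mult[OF r continuous_on_reflect] q f)
  ultimately show "apply_bcontfun (conv m q (ltrans g f)) x = apply_bcontfun (\<delta> *\<^sub>R conv m (rtrans (- g) q) f) x"
    by (simp add: apply_conv q(1) r)
qed

end

subsection \<open>The invariant integral\<close>

context
  fixes m :: "('a::{topological_group_add, t2_space} \<Rightarrow>\<^sub>C real) \<Rightarrow> real" and f \<phi> :: "'a \<Rightarrow>\<^sub>C real"
  assumes lc: "locally_compact_space (euclidean :: 'a topology)"
    and haar: "haar_integral m"
    and f: "f \<in> Cb_ru" "\<And>x. 0 \<le> apply_bcontfun f x"
    and \<phi>: "\<phi> \<in> Cc" "\<And>x. 0 \<le> apply_bcontfun \<phi> x" "\<phi> \<noteq> 0"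
begin

lemma conv_self_dominated: "conv m \<phi> f \<in> dominated_by_translates Cb_ru (conv m \<phi> f)"
  using \<phi> f by (intro self_dominated conv_Cb_ru[OF lc haar] conv_nonneg[OF lc haar])

lemma subspace_dominated_conv: "subspace (dominated_by_translates Cb_ru (conv m \<phi> f))"
  using \<phi> f by (intro subspace_dominated conv_nonneg[OF lc haar])

text \<open>A finite sum of translates of \<open>\<phi>\<close> majorizes \<open>q\<close>, and left
  translations of the first factor can be pulled out of the convolution.\<close>

lemma conv_dominated_left:
  assumes q: "q \<in> Cc"
  shows "conv m q f \<in> dominated_by_translates Cb_ru (conv m \<phi> f)"
proof -
  have "q \<in> dominated_by_translates Cb_ru \<phi>"
    using \<phi> Cc_subset_Cb_ru[OF lc] by (intro Cc_dominated[OF lc q]) auto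
  then obtain n and g :: "nat \<Rightarrow> 'a"
    where g: "\<And>x. \<bar>apply_bcontfun q x\<bar> \<le> apply_bcontfun (\<Sum>j<n. ltrans (g j) \<phi>) x"
    unfolding dominated_by_translates_def by blast
  let ?s = "\<Sum>j<n. ltrans (g j) \<phi>"
  have s: "?s \<in> Cc" by (intro subspace_sum[OF subspace_Cc] ltrans_Cc \<phi>)
  have "conv m ?s f = (\<Sum>j<n. ltrans (g j) (conv m \<phi> f))"
    by (simp add: conv_sum_left[OF lc haar] ltrans_Cc \<phi> ltrans_conv[OF lc haar])
  then have "conv m ?s f \<in> dominated_by_translates Cb_ru (conv m \<phi> f)"
    by (simp add: subspace_sum[OF subspace_dominated_conv] ltrans_dominated conv_self_dominated)
  moreover have "\<bar>apply_bcontfun (conv m q f) x\<bar> \<le> \<bar>apply_bcontfun (conv m ?s f) x\<bar>" for x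
    using conv_abs_le[OF lc haar q s g, of f f x] f(2) by force
  ultimately show ?thesis
    using conv_Cb_ru[OF lc haar q] by (rule dominated_mono[rotated])
qed

text \<open>Each translation of \<open>f\<close> is traded for a right translation of
  \<open>q\<close>, which stays in \<open>Cc\<close>, so that only convolutions with
  \<open>f\<close> itself remain.\<close>

lemma conv_dominated_sum:
  assumes q: "q \<in> Cc" "\<And>x. 0 \<le> apply_bcontfun q x"
  shows "conv m q (\<Sum>j<n. ltrans (g j) f) \<in> dominated_by_translates Cb_ru (conv m \<phi> f)"
proof -
  have "conv m q (ltrans h f) \<in> dominated_by_translates Cb_ru (conv m \<phi> f)" for h
  proof -
    obtain \<delta> where "\<And>k. k \<in> Cc \<Longrightarrow> (\<And>x. 0 \<le> apply_bcontfun k x) \<Longrightarrow> m (rtrans h k) = \<delta> * m k"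
      by (rule haar_modular[OF lc haar, of h]) blast
    then have "conv m q (ltrans h f) = \<delta> *\<^sub>R conv m (rtrans (- h) q) f"
      by (rule conv_ltrans_right[OF lc haar _ q f(2)])
    then show ?thesis
      by (simp add: subspace_scale[OF subspace_dominated_conv] conv_dominated_left rtrans_Cc q)
  qed
  then show ?thesis
    by (simp add: conv_sum_right[OF lc haar q(1)] subspace_sum[OF subspace_dominated_conv])
qed

text \<open>Let \<open>?H\<close> be a sum of translates of \<open>f\<close> above \<open>h\<close>.
  Its convolution with a majorant of \<open>q\<close> dominates the function, and its convolution
  with an oscillation weight of \<open>q\<close> is a weight for the oscillation.\<close>

lemma conv_uniformly_dominated:
  assumes q: "q \<in> Cc" and h: "h \<in> dominated_by_translates Cb_ru f"
  shows "conv m q h \<in> uniformly_dominated (conv m \<phi> f)"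
proof -
  obtain n and g :: "nat \<Rightarrow> 'a"
    where g: "\<And>x. \<bar>apply_bcontfun h x\<bar> \<le> apply_bcontfun (\<Sum>j<n. ltrans (g j) f) x"
    using h unfolding dominated_by_translates_def by blast
  let ?H = "\<Sum>j<n. ltrans (g j) f"
  obtain r where r: "r \<in> Cc" "\<And>x. \<bar>apply_bcontfun q x\<bar> \<le> apply_bcontfun r x"
    by (rule Cc_majorant[OF lc q]) blast
  have "0 \<le> apply_bcontfun r x" for x using r(2)[of x] by linarith
  then have "conv m r ?H \<in> dominated_by_translates Cb_ru (conv m \<phi> f)"
    by (rule conv_dominated_sum[OF r(1)])
  moreover have "\<bar>apply_bcontfun (conv m q h) x\<bar> \<le> \<bar>apply_bcontfun (conv m r ?H) x\<bar>" for x
    using conv_abs_le[OF lc haar q r g, of x] by linarith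
  ultimately have "conv m q h \<in> dominated_by_translates Cb_ru (conv m \<phi> f)"
    using conv_Cb_ru[OF lc haar q] by (rule dominated_mono[rotated])
  moreover obtain p where p: "p \<in> Cc" "dominated_oscillation q p"
    by (rule Cc_left_oscillation[OF lc q]) blast
  have "dominated_oscillation (conv m q h) (conv m p ?H)"
    using q p g by (rule dominated_oscillation_conv[OF lc haar])
  moreover have "conv m p ?H \<in> dominated_by_translates Cb_ru (conv m \<phi> f)"
    by (rule conv_dominated_sum[OF p(1) dominated_oscillation_nonneg[OF p(2)]])
  ultimately show ?thesis unfolding uniformly_dominated_def by blast
qed

text \<open>Replacing \<open>h\<close> by its translate by \<open>g\<close> in \<open>\<phi> * h\<close> amounts to right translating \<open>\<phi>\<close> and multiplying by
  the modular function at \<open>g\<close>. By uniqueness of the Haar integral, the invariant functional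
  \<open>\<psi> \<mapsto> I (\<psi> * h)\<close> scales under right translations by the inverse factor.\<close>

lemma conv_integral_invariant:
  assumes I: "positive_linear_on (uniformly_dominated (conv m \<phi> f)) I"
    and inv: "\<And>h g. h \<in> uniformly_dominated (conv m \<phi> f) \<Longrightarrow> I (ltrans g h) = I h"
    and h: "h \<in> dominated_by_translates Cb_ru f" "\<And>x. 0 \<le> apply_bcontfun h x"
  shows "I (conv m \<phi> (ltrans g h)) = I (conv m \<phi> h)"
proof -
  note mem = conv_uniformly_dominated[OF _ h(1)]
  define \<Phi> where "\<Phi> \<psi> = I (conv m \<psi> h)" for \<psi>
  \<comment> \<open>The sign of \<open>h\<close> makes \<open>\<Phi>\<close> positive, as the
    uniqueness result requires.\<close>
  have "positive_linear_on Cc \<Phi>"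
    unfolding positive_linear_on_def \<Phi>_def
    using h(2) by (auto simp: subspace_Cc conv_add_left[OF lc haar] conv_scale_left[OF lc haar]
        plin_add[OF I] plin_scale[OF I] mem intro!: plin_nonneg[OF I] conv_nonneg[OF lc haar])
  moreover have "\<Phi> (ltrans u \<psi>) = \<Phi> \<psi>" if "\<psi> \<in> Cc" for u \<psi>
    using inv[OF mem[OF that], of u] ltrans_conv[OF lc haar that, of u h] by (simp add: \<Phi>_def)
  moreover have r: "rtrans (- g) \<phi> \<in> Cc" "\<And>x. 0 \<le> apply_bcontfun (rtrans (- g) \<phi>) x"
    using \<phi> by (simp_all add: rtrans_Cc)
  ultimately have *: "\<Phi> (rtrans (- g) \<phi>) * m \<phi> = \<Phi> \<phi> * m (rtrans (- g) \<phi>)"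
    using \<phi>(1,2) by (intro haar_unique[OF lc haar])
  obtain \<delta> where \<delta>: "\<And>k. k \<in> Cc \<Longrightarrow> (\<And>x. 0 \<le> apply_bcontfun k x) \<Longrightarrow> m (rtrans g k) = \<delta> * m k"
    by (rule haar_modular[OF lc haar, of g]) blast
  have "rtrans g (rtrans (- g) \<phi>) = \<phi>" by (rule bcontfun_eqI) (simp add: add.assoc)
  then have "m \<phi> = \<delta> * m (rtrans (- g) \<phi>)" using \<delta>[OF r] by simp
  moreover have "I (conv m \<phi> (ltrans g h)) = \<delta> * \<Phi> (rtrans (- g) \<phi>)"
  proof -
    have "conv m \<phi> (ltrans g h) = \<delta> *\<^sub>R conv m (rtrans (- g) \<phi>) h"
      using \<delta> \<phi>(1,2) h(2) by (rule conv_ltrans_right[OF lc haar])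
    then show ?thesis by (simp add: plin_scale[OF I mem[OF r(1)]] \<Phi>_def)
  qed
  \<comment> \<open>The factor \<open>\<delta>\<close> occurs once from translating \<open>h\<close>
    and once in \<open>m \<phi>\<close>; the uniqueness identity \<open>*\<close> matches the two
    occurrences.\<close>
  ultimately have "I (conv m \<phi> (ltrans g h)) * m \<phi> = \<Phi> \<phi> * m \<phi>"
    using * by (metis mult.assoc mult.commute)
  moreover have "0 < m \<phi>" using \<phi> by (intro haar_pos[OF lc haar])
  ultimately show ?thesis by (simp add: \<Phi>_def)
qed

end

theorem theorem6:
  assumes "locally_compact_space (euclidean :: 'a::{topological_group_add, t2_space} topology)"
    and "translate_property (Cb_ru :: ('a \<Rightarrow>\<^sub>C real) set)"
  shows "invariant_normalized_integral_property (Cb_ru :: ('a \<Rightarrow>\<^sub>C real) set)"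
  unfolding invariant_normalized_integral_property_def
proof (intro ballI impI, elim conjE)
  fix f :: "'a \<Rightarrow>\<^sub>C real"
  assume f: "f \<in> Cb_ru" "f \<noteq> 0" and "\<forall>x. 0 \<le> apply_bcontfun f x"
  then have nonneg: "\<And>x. 0 \<le> apply_bcontfun f x" by blast
  note lc = assms(1) and tp = assms(2)
  let ?V = "dominated_by_translates Cb_ru f"
  have fV: "f \<in> ?V" and V: "subspace ?V"
    using f nonneg by (auto intro: self_dominated subspace_dominated)
  obtain m :: "('a \<Rightarrow>\<^sub>C real) \<Rightarrow> real" where haar: "haar_integral m"
    by (rule translate_property_haar_integral[OF lc tp])
  obtain \<phi> :: "'a \<Rightarrow>\<^sub>C real" where \<phi>: "\<phi> \<in> Cc" "\<And>x. 0 \<le> apply_bcontfun \<phi> x" "apply_bcontfun \<phi> 0 = 1" "\<phi> \<noteq> 0"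
    by (rule Cc_bump_zero[OF lc]) blast
  note mem = conv_uniformly_dominated[OF lc haar f(1) nonneg \<phi>(1,2,4) \<phi>(1)]
  define F where "F = conv m \<phi> f"
  \<comment> \<open>\<open>F\<close> is uniformly dominated by itself, which is not known for
    \<open>f\<close>; so the invariant integral can be constructed for \<open>F\<close>.\<close>
  have F: "F \<in> uniformly_dominated F" unfolding F_def by (rule mem[OF fV])
  have Fnonneg: "0 \<le> apply_bcontfun F x" for x
    unfolding F_def using \<phi>(1,2) nonneg by (rule conv_nonneg[OF lc haar])
  have "F \<noteq> 0"
  proof
    assume "F = 0"
    \<comment> \<open>\<open>F\<close> is nonzero at any \<open>a\<close> where \<open>f\<close> is:
      the integrand for \<open>F\<close> at \<open>a\<close> is nonnegative and its value at 0 is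
      that of \<open>f\<close> at \<open>a\<close>, since \<open>\<phi>\<close> is 1 at 0.\<close>
    obtain a where a: "apply_bcontfun f a \<noteq> 0" using f(2) by (metis bcontfun_eqI zero_bcontfun.rep_eq)
    let ?k = "Cc_mult \<phi> (\<lambda>y. apply_bcontfun f (- y + a))"
    have k: "apply_bcontfun ?k y = apply_bcontfun \<phi> y * apply_bcontfun f (- y + a)" for y
      by (rule apply_Cc_mult[OF \<phi>(1) continuous_on_reflect])
    have "apply_bcontfun ?k 0 \<noteq> 0" using a \<phi>(3) by (simp add: k)
    then have "?k \<noteq> 0" by (metis zero_bcontfun.rep_eq)
    then have "0 < m ?k"
      using \<phi>(2) nonneg by (intro haar_pos[OF lc haar] Cc_mult_Cc[OF \<phi>(1) continuous_on_reflect]) (simp_all add: k)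
    then have "0 < apply_bcontfun F a" unfolding F_def apply_conv[OF lc haar \<phi>(1)] .
    then show False using \<open>F = 0\<close> by simp
  qed
  from invariant_integral_uniformly_dominated[OF tp F this Fnonneg]
  obtain I where I: "positive_linear_on (uniformly_dominated F) I"
    and inv: "\<And>h g. h \<in> uniformly_dominated F \<Longrightarrow> I (ltrans g h) = I h" and IF: "I F = 1" by blast
  note mem' = mem[folded F_def]
  define J where "J h = I (conv m \<phi> h)" for h
  have J: "positive_linear_on ?V J"
    unfolding positive_linear_on_def J_def
    using \<phi>(1,2) by (auto simp: V conv_add_right[OF lc haar] conv_scale_right[OF lc haar]
        plin_add[OF I] plin_scale[OF I] mem' intro!: plin_nonneg[OF I] conv_nonneg[OF lc haar])
  have Jinv_nonneg: "J (ltrans g h) = J h" if "h \<in> ?V" "\<And>x. 0 \<le> apply_bcontfun h x" for g h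
    unfolding J_def
    by (rule conv_integral_invariant[OF lc haar f(1) nonneg \<phi>(1,2,4) I[unfolded F_def] inv[unfolded F_def] that])
  \<comment> \<open>A general \<open>h\<close> is the difference of the nonnegative dominated
    functions \<open>H'\<close> and \<open>H' - h\<close>, where \<open>H'\<close> is a sum of
    translates of \<open>f\<close> above \<open>\<bar>h\<bar>\<close>; linearity of \<open>J\<close>
    carries invariance over to \<open>h\<close>.\<close>
  have Jinv: "J (ltrans g h) = J h" if h: "h \<in> ?V" for g h
  proof -
    obtain n and a :: "nat \<Rightarrow> 'a" where H: "(\<Sum>j<n. ltrans (a j) f) \<in> ?V"
      "\<And>x. \<bar>apply_bcontfun h x\<bar> \<le> apply_bcontfun (\<Sum>j<n. ltrans (a j) f) x"
      by (rule dominated_obtain[OF f(1) nonneg h]) blast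
    define H' where "H' = (\<Sum>j<n. ltrans (a j) f)"
    have H': "H' \<in> ?V" "\<And>x. \<bar>apply_bcontfun h x\<bar> \<le> apply_bcontfun H' x" using H by (simp_all add: H'_def)
    have d: "H' - h \<in> ?V" using subspace_diff[OF V H'(1) h] .
    have "0 \<le> apply_bcontfun H' x" "0 \<le> apply_bcontfun (H' - h) x" for x
      using H'(2)[of x] by (simp_all add: abs_le_iff) 
    then have "J (ltrans g H') = J H'" "J (ltrans g (H' - h)) = J (H' - h)"
      using H'(1) d by (auto intro: Jinv_nonneg)
    then show ?thesis
      using plin_diff[OF J H'(1) h] plin_diff[OF J ltrans_dominated[OF H'(1)] ltrans_dominated[OF h], of g g]
      by (simp add: ltrans_diff)
  qed
  have "invariant_normalized_integral Cb_ru f J"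
    unfolding invariant_normalized_integral_def Let_def
    using plin_add[OF J] plin_scale[OF J] plin_nonneg[OF J] Jinv IF by (simp add: J_def F_def)
  then show "\<exists>I. invariant_normalized_integral Cb_ru f I" by blast
qed

end
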